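(* There is an isomorphism $\phi:\mathcal{Q}_{\mathbb{Z}}\to\mathcal{Q}(\mathbb{Z}\rtimes\mathbb{Z}^\times)$ satisfying $\phi(s)=s_{(1,1)}$ and $$\phi(v_a)=s_{(0,a/|a|)}\,t_{(0,|a|)}\quad\text{for all }a\in\mathbb{Z}^\times.$$
   Context: $\mathbb{Z}^\times=\mathbb{Z}\setminus\{0\}$ under multiplication, and $\mathbb{Z}\rtimes\mathbb{Z}^\times$ is the semigroup $\mathbb{Z}\times\mathbb{Z}^\times$ with $(m,a)(n,b)=(m+an,ab)$ and identity $(0,1)$. $\mathcal{Q}_{\mathbb{Z}}$ is the universal $C^*$-algebra generated by a unitary $s$ and isometries $\{v_a:a\in\mathbb{Z}^\times\}$ satisfying: (i) $v_av_b=v_{ab}$ for all $a,b\in\mathbb{Z}^\times$; (ii) $v_as=s^av_a$ and $v_as^*=(s^* )^av_a$ for all $a\in\mathbb{Z}^\times$ (for negative exponents, powers of the unitary are powers of its inverse); (iii) $\sum_{j=0}^{|a|-1}s^jv_av_a^*(s^* )^j=1$ for all $a\in\mathbb{Z}^\times$. Boundary quotient: $P=\mathbb{Z}\rtimes\mathbb{Z}^\times$ is a left-cancellative right LCM semigroup (if $pP\cap qP\ne\varnothing$ then $pP\cap qP=rP$ for some $r\in P$). Put $pX=\{px:x\in X\}$ for $X\subseteq P$, and $\mathcal{J}(P)=\{pP:p\in P\}\cup\{\varnothing\}$. A subset $F\subseteq P$ is a foundation set if it is finite and for each $p\in P$ there is $q\in F$ with $pP\cap qP\neq\varnothing$. $\mathcal{Q}(P)$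 is the universal $C^*$-algebra generated by isometries $\{w_p:p\in P\}$ and projections $\{e_X:X\in\mathcal{J}(P)\}$ satisfying $w_pw_q=w_{pq}$; $w_pe_Xw_p^*=e_{pX}$; $e_P=1$, $e_\varnothing=0$; $e_Xe_Y=e_{X\cap Y}$; and $\prod_{p\in F}(1-e_{pP})=0$ for all foundation sets $F\subseteq P$. $\mathbb{Z}\rtimes\mathbb{Z}^\times$ is the internal Zappa--Szép product of its subsemigroups $U=\{(r,x):x\ge1,\ 0\le r<x\}$ and $A=\mathbb{Z}\times\{1,-1\}$: every element is uniquely a product $ua$ with $u\in U$, $a\in A$. In $\mathcal{Q}(\mathbb{Z}\rtimes\mathbb{Z}^\times)$ write $t_u:=w_u$ for $u\in U$ and $s_g:=w_g$ for $g\in A$ (the canonical generating isometries); thus $s_{(1,1)}=w_{(1,1)}$, $s_{(0,a/|a|)}=w_{(0,a/|a|)}$ and $t_{(0,|a|)}=w_{(0,|a|)}$. *)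

theory Defs
  imports Complex_Main "HOL-Algebra.Module" "HOL-Algebra.QuotRing" "HOL-Library.Poly_Mapping"
begin

section \<open>The free unital star-algebra\<close>

text \<open>A letter \<open>(x, False)\<close> is the generator \<open>x\<close>, a letter \<open>(x, True)\<close> its adjoint. Words are
  wrapped in a datatype so that concatenation can serve as the monoid addition from which
  \<open>Poly_Mapping\<close> builds its convolution product; \<open>'g star_poly\<close> is then the free unital complex
  star-algebra on \<open>'g\<close>, i.e. noncommutative polynomials in the generators and their adjoints.\<close>

datatype 'g word = Word (letters: "('g \<times> bool) list")

instantiation word :: (type) monoid_add
begin
definition zero_word :: "'a word" where "0 = Word []"
definition plus_word :: "'a word \<Rightarrow> 'a word \<Rightarrow> 'a word" where "u + v = Word (letters u @ letters v)"
instance by standard (simp_all add: zero_word_def plus_word_def)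
end

type_synonym 'g star_poly = "'g word \<Rightarrow>\<^sub>0 complex"

definition gen :: "'g \<Rightarrow> 'g star_poly" where
  "gen x = Poly_Mapping.single (Word [(x, False)]) 1"

definition scal :: "complex \<Rightarrow> 'g star_poly" where
  "scal c = Poly_Mapping.single 0 c"

definition adj_word :: "'g word \<Rightarrow> 'g word" where
  "adj_word w = Word (rev (map (\<lambda>(x, b). (x, \<not> b)) (letters w)))"

definition adj :: "'g star_poly \<Rightarrow> 'g star_poly" where
  "adj x = (\<Sum>w\<in>Poly_Mapping.keys x. Poly_Mapping.single (adj_word w) (cnj (Poly_Mapping.lookup x w)))"

definition free_alg :: "'g set \<Rightarrow> 'g star_poly set" where
  "free_alg G = {x. \<forall>w\<in>Poly_Mapping.keys x. fst ` set (letters w) \<subseteq> G}"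


section \<open>C*-algebras and the universal C*-algebra of a presentation\<close>

record 'a cstar_struct = "(complex, 'a) module" +
  star :: "'a \<Rightarrow> 'a"
  cnorm :: "'a \<Rightarrow> real"

text \<open>Unital star-isomorphisms. Between C*-algebras the last clause (isometry) is automatic.\<close>

definition cstar_iso :: "('a, 'm) cstar_struct_scheme \<Rightarrow> ('b, 'n) cstar_struct_scheme \<Rightarrow> ('a \<Rightarrow> 'b) set" where
  "cstar_iso A B = {\<phi> \<in> ring_iso A B. \<forall>x\<in>carrier A.
      (\<forall>c. \<phi> (c \<odot>\<^bsub>A\<^esub> x) = c \<odot>\<^bsub>B\<^esub> \<phi> x) \<and> \<phi> (star A x) = star B (\<phi> x) \<and> cnorm B (\<phi> x) = cnorm A x}"

definition cstar_seminorm :: "'g set \<Rightarrow> 'g star_poly set \<Rightarrow> ('g star_poly \<Rightarrow> real) \<Rightarrow> bool" where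
  "cstar_seminorm G R p \<longleftrightarrow>
     (\<forall>x\<in>free_alg G. \<forall>y\<in>free_alg G. p (x + y) \<le> p x + p y \<and> p (x * y) \<le> p x * p y) \<and>
     (\<forall>x\<in>free_alg G. (\<forall>c. p (scal c * x) = cmod c * p x) \<and> p (adj x * x) = (p x)\<^sup>2) \<and>
     (\<forall>r\<in>R. p r = 0)"

text \<open>The universal C*-algebra on generators \<open>G\<close> subject to the relations \<open>r = 0\<close> for \<open>r \<in> R\<close>
  is the separated completion of the free star-algebra on \<open>G\<close> for the norm
  \<open>sup \<parallel>\<pi> x\<parallel>\<close>, where \<open>\<pi>\<close> ranges over the star-homomorphisms to C*-algebras that satisfy the
  relations. The functions \<open>x \<mapsto> \<parallel>\<pi> x\<parallel>\<close> are exactly the C*-seminorms that vanish on \<open>R\<close> (a C*-seminorm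
  is induced by the map to its own separated completion), so the supremum can be taken over
  these, without quantifying over types. As usual the presentation is required to be admissible,
  i.e. the supremum to be finite (lemmas \<open>QZ_admissible\<close>, \<open>BQ_admissible\<close>); \<open>Sup\<close> is unspecified otherwise.\<close>

definition univ_norm :: "'g set \<Rightarrow> 'g star_poly set \<Rightarrow> 'g star_poly \<Rightarrow> real" where
  "univ_norm G R x = Sup {p x | p. cstar_seminorm G R p}"

definition univ_cauchy :: "'g set \<Rightarrow> 'g star_poly set \<Rightarrow> (nat \<Rightarrow> 'g star_poly) set" where
  "univ_cauchy G R = {f. range f \<subseteq> free_alg G \<and>
     (\<forall>\<epsilon>>0. \<exists>N. \<forall>m\<ge>N. \<forall>n\<ge>N. univ_norm G R (f m - f n) < \<epsilon>)}"

definition univ_rel :: "'g set \<Rightarrow> 'g star_poly set \<Rightarrow> (nat \<Rightarrow> 'g star_poly) rel" where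
  "univ_rel G R = {(f, g). f \<in> univ_cauchy G R \<and> g \<in> univ_cauchy G R \<and>
     (\<lambda>n. univ_norm G R (f n - g n)) \<longlonglongrightarrow> 0}"

definition univ_class :: "'g set \<Rightarrow> 'g star_poly set \<Rightarrow> (nat \<Rightarrow> 'g star_poly) \<Rightarrow> (nat \<Rightarrow> 'g star_poly) set" where
  "univ_class G R f = univ_rel G R `` {f}"

definition univ_cstar :: "'g set \<Rightarrow> 'g star_poly set \<Rightarrow> (nat \<Rightarrow> 'g star_poly) set cstar_struct" where
  "univ_cstar G R = \<lparr>
     carrier = univ_cauchy G R // univ_rel G R,
     mult = (\<lambda>X Y. \<Union>f\<in>X. \<Union>g\<in>Y. univ_class G R (\<lambda>n. f n * g n)),
     one = univ_class G R (\<lambda>_. 1),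
     zero = univ_class G R (\<lambda>_. 0),
     add = (\<lambda>X Y. \<Union>f\<in>X. \<Union>g\<in>Y. univ_class G R (\<lambda>n. f n + g n)),
     smult = (\<lambda>c X. \<Union>f\<in>X. univ_class G R (\<lambda>n. scal c * f n)),
     star = (\<lambda>X. \<Union>f\<in>X. univ_class G R (\<lambda>n. adj (f n))),
     cnorm = (\<lambda>X. lim (\<lambda>n. univ_norm G R ((SOME f. f \<in> X) n)))\<rparr>"

definition univ_gen :: "'g set \<Rightarrow> 'g star_poly set \<Rightarrow> 'g \<Rightarrow> (nat \<Rightarrow> 'g star_poly) set" where
  "univ_gen G R x = univ_class G R (\<lambda>_. gen x)"


section \<open>The algebra \<open>Q\<^sub>\<int>\<close>\<close>

datatype qz_gen = S | V int

definition qz_gens :: "qz_gen set" where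
  "qz_gens = {S} \<union> V ` {a. a \<noteq> 0}"

text \<open>Integer powers of a unitary, whose inverse is its adjoint.\<close>

definition upow :: "'g star_poly \<Rightarrow> int \<Rightarrow> 'g star_poly" where
  "upow u k = (if 0 \<le> k then u ^ nat k else adj u ^ nat (- k))"

definition qz_rels :: "qz_gen star_poly set" where
  "qz_rels = (let s = gen S; v = (\<lambda>a. gen (V a)) in
     {adj s * s - 1, s * adj s - 1}
   \<union> {adj (v a) * v a - 1 | a. a \<noteq> 0}
   \<union> {v a * v b - v (a * b) | a b. a \<noteq> 0 \<and> b \<noteq> 0}
   \<union> {v a * s - upow s a * v a | a. a \<noteq> 0}
   \<union> {v a * adj s - upow (adj s) a * v a | a. a \<noteq> 0}
   \<union> {(\<Sum>j<nat \<bar>a\<bar>. s ^ j * v a * adj (v a) * adj s ^ j) - 1 | a. a \<noteq> 0})"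

definition QZ :: "(nat \<Rightarrow> qz_gen star_poly) set cstar_struct" where
  "QZ = univ_cstar qz_gens qz_rels"

definition qz_s :: "(nat \<Rightarrow> qz_gen star_poly) set" where
  "qz_s = univ_gen qz_gens qz_rels S"

definition qz_v :: "int \<Rightarrow> (nat \<Rightarrow> qz_gen star_poly) set" where
  "qz_v a = univ_gen qz_gens qz_rels (V a)"


section \<open>The boundary quotient of a right LCM monoid\<close>

definition translate :: "('p, 'm) monoid_scheme \<Rightarrow> 'p \<Rightarrow> 'p set \<Rightarrow> 'p set" where
  "translate P p X = (\<lambda>x. p \<otimes>\<^bsub>P\<^esub> x) ` X"

definition right_ideal :: "('p, 'm) monoid_scheme \<Rightarrow> 'p \<Rightarrow> 'p set" where
  "right_ideal P p = translate P p (carrier P)"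

definition constructible_ideals :: "('p, 'm) monoid_scheme \<Rightarrow> 'p set set" where
  "constructible_ideals P = right_ideal P ` carrier P \<union> {{}}"

definition foundation_set :: "('p, 'm) monoid_scheme \<Rightarrow> 'p set \<Rightarrow> bool" where
  "foundation_set P F \<longleftrightarrow> F \<subseteq> carrier P \<and> finite F \<and>
     (\<forall>p\<in>carrier P. \<exists>q\<in>F. right_ideal P p \<inter> right_ideal P q \<noteq> {})"

datatype 'p bq_gen = W 'p | E "'p set"

definition bq_gens :: "('p, 'm) monoid_scheme \<Rightarrow> 'p bq_gen set" where
  "bq_gens P = W ` carrier P \<union> E ` constructible_ideals P"

text \<open>In the last family the product over a foundation set is taken along every enumeration of
  it; the factors commute by virtue of the other relations. The right LCM property makes
  \<open>constructible_ideals P\<close> closed under intersection, so \<open>E (X \<inter> Y)\<close> is again a generator.\<close>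

definition bq_rels :: "('p, 'm) monoid_scheme \<Rightarrow> 'p bq_gen star_poly set" where
  "bq_rels P = (let w = (\<lambda>p. gen (W p)); e = (\<lambda>X. gen (E X)); J = constructible_ideals P in
     {adj (w p) * w p - 1 | p. p \<in> carrier P}
   \<union> {adj (e X) - e X | X. X \<in> J}
   \<union> {e X * e X - e X | X. X \<in> J}
   \<union> {w p * w q - w (p \<otimes>\<^bsub>P\<^esub> q) | p q. p \<in> carrier P \<and> q \<in> carrier P}
   \<union> {w p * e X * adj (w p) - e (translate P p X) | p X. p \<in> carrier P \<and> X \<in> J}
   \<union> {e (carrier P) - 1, e {}}
   \<union> {e X * e Y - e (X \<inter> Y) | X Y. X \<in> J \<and> Y \<in> J}
   \<union> {prod_list (map (\<lambda>p. 1 - e (right_ideal P p)) ps) | ps. distinct ps \<and> foundation_set P (set ps)})"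

definition BQ :: "('p, 'm) monoid_scheme \<Rightarrow> (nat \<Rightarrow> 'p bq_gen star_poly) set cstar_struct" where
  "BQ P = univ_cstar (bq_gens P) (bq_rels P)"

definition bq_w :: "('p, 'm) monoid_scheme \<Rightarrow> 'p \<Rightarrow> (nat \<Rightarrow> 'p bq_gen star_poly) set" where
  "bq_w P p = univ_gen (bq_gens P) (bq_rels P) (W p)"


section \<open>The monoid \<open>\<int> \<rtimes> \<int>\<^sup>\<times>\<close> and its Zappa-Szep factors\<close>

definition ZZ :: "(int \<times> int) monoid" where
  "ZZ = \<lparr>carrier = {(m, a). a \<noteq> 0}, mult = (\<lambda>(m, a) (n, b). (m + a * n, a * b)), one = (0, 1)\<rparr>"

definition zz_U :: "(int \<times> int) set" where
  "zz_U = {(r, x). 1 \<le> x \<and> 0 \<le> r \<and> r < x}"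

definition zz_A :: "(int \<times> int) set" where
  "zz_A = UNIV \<times> {1, -1}"

definition zz_t :: "int \<times> int \<Rightarrow> (nat \<Rightarrow> (int \<times> int) bq_gen star_poly) set" where
  "zz_t = restrict (bq_w ZZ) zz_U"

definition zz_s :: "int \<times> int \<Rightarrow> (nat \<Rightarrow> (int \<times> int) bq_gen star_poly) set" where
  "zz_s = restrict (bq_w ZZ) zz_A"


section \<open>Admissibility\<close>

lemma free_alg_simps [simp]:
  "1 \<in> free_alg G" "0 \<in> free_alg G" "scal c \<in> free_alg G"
  "gen x \<in> free_alg G \<longleftrightarrow> x \<in> G"
  by (auto simp: free_alg_def gen_def scal_def zero_word_def keys_one)

lemma free_alg_add: "x \<in> free_alg G \<Longrightarrow> y \<in> free_alg G \<Longrightarrow> x + y \<in> free_alg G"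
  using Poly_Mapping.keys_add[of x y] unfolding free_alg_def by blast

lemma free_alg_mult: "x \<in> free_alg G \<Longrightarrow> y \<in> free_alg G \<Longrightarrow> x * y \<in> free_alg G"
  using keys_mult[of x y] unfolding free_alg_def by (fastforce simp: plus_word_def)

lemma adj_single: "adj (Poly_Mapping.single w c) = Poly_Mapping.single (adj_word w) (cnj c)"
  by (cases "c = 0") (simp_all add: adj_def)

lemma adj_gen: "adj (gen x) = Poly_Mapping.single (Word [(x, True)]) 1"
  by (simp add: gen_def adj_single adj_word_def)

lemma adj_adj_gen: "adj (adj (gen x)) = gen x"
  by (simp add: adj_gen adj_single adj_word_def) (simp add: gen_def)

lemma adj_gen_free: "adj (gen x) \<in> free_alg G \<longleftrightarrow> x \<in> G"
  by (simp add: adj_gen free_alg_def)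

lemma free_alg_single: "fst ` set (letters w) \<subseteq> G \<Longrightarrow> Poly_Mapping.single w c \<in> free_alg G"
  by (auto simp: free_alg_def)

lemma free_alg_diff: "x \<in> free_alg G \<Longrightarrow> y \<in> free_alg G \<Longrightarrow> x - y \<in> free_alg G"
  using Poly_Mapping.keys_diff[of x y] unfolding free_alg_def by blast

lemma star_poly_monomials:
  "(\<Sum>w\<in>Poly_Mapping.keys x. Poly_Mapping.single w (Poly_Mapping.lookup x w)) = (x :: 'g star_poly)"
proof (rule poly_mapping_eqI)
  fix k
  show "Poly_Mapping.lookup (\<Sum>w\<in>Poly_Mapping.keys x. Poly_Mapping.single w (Poly_Mapping.lookup x w)) k
      = Poly_Mapping.lookup x k"
    by (auto simp: lookup_sum lookup_single when_def sum.delta in_keys_iff)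
qed

lemma cstar_seminormD:
  assumes "cstar_seminorm G R p"
  shows "x \<in> free_alg G \<Longrightarrow> y \<in> free_alg G \<Longrightarrow> p (x + y) \<le> p x + p y"
    and "x \<in> free_alg G \<Longrightarrow> y \<in> free_alg G \<Longrightarrow> p (x * y) \<le> p x * p y"
    and "x \<in> free_alg G \<Longrightarrow> p (scal c * x) = cmod c * p x"
    and "x \<in> free_alg G \<Longrightarrow> p (adj x * x) = (p x)\<^sup>2"
    and "r \<in> R \<Longrightarrow> p r = 0"
  using assms by (auto simp: cstar_seminorm_def)

lemma cstar_seminorm_zero: "cstar_seminorm G R p \<Longrightarrow> p 0 = 0"
  using cstar_seminormD(3)[of G R p 0 0] by simp

lemma cstar_seminorm_nonneg:
  assumes p: "cstar_seminorm G R p" and x: "x \<in> free_alg G"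
  shows "0 \<le> p x"
proof -
  have eq: "scal (- 1) * x = - x"
    by (metis mult_minus1 scal_def single_one single_uminus)
  have "p (- x) = p x"
    using cstar_seminormD(3)[OF p x, of "- 1"] eq by simp
  moreover have "- x \<in> free_alg G"
    using x by (simp add: free_alg_def)
  ultimately show ?thesis
    using cstar_seminormD(1)[OF p x, of "- x"] cstar_seminorm_zero[OF p] by simp
qed

lemma square_le_self: "(t::real)\<^sup>2 \<le> t \<Longrightarrow> t \<le> 1"
  using mult_strict_left_mono[of 1 t t] by (cases "1 < t") (auto simp: power2_eq_square)

lemma adj_one [simp]: "adj 1 = (1 :: 'a star_poly)"
proof -
  have "adj_word 0 = (0 :: 'a word)"
    by (simp add: adj_word_def zero_word_def)
  then show ?thesis
    using adj_single[of "0 :: 'a word" 1] by simp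
qed

lemma cstar_seminorm_one: "cstar_seminorm G R p \<Longrightarrow> p 1 \<le> 1"
  using cstar_seminormD(4)[of G R p 1] by (intro square_le_self) (metis adj_one free_alg_simps(1) mult_1 order_refl)

lemma cstar_seminorm_adj_gen:
  assumes p: "cstar_seminorm G R p" and x: "x \<in> G"
  shows "p (adj (gen x)) = p (gen x)"
proof -
  have le: "p y \<le> p (adj y)" if y: "y \<in> free_alg G" "adj y \<in> free_alg G" for y
  proof (cases "p y = 0")
    case True
    then show ?thesis using cstar_seminorm_nonneg[OF p y(2)] by simp
  next
    case False
    then have "0 < p y" using cstar_seminorm_nonneg[OF p y(1)] by simp
    moreover have "p y * p y \<le> p (adj y) * p y"
      using cstar_seminormD(2)[OF p y(2,1)] cstar_seminormD(4)[OF p y(1)] by (simp add: power2_eq_square)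
    ultimately show ?thesis by simp
  qed
  show ?thesis
    using le[of "gen x"] le[of "adj (gen x)"] x by (simp add: adj_adj_gen adj_gen_free)
qed

lemma bdd_above_seminorms:
  assumes gens: "\<And>p g. cstar_seminorm G R p \<Longrightarrow> g \<in> G \<Longrightarrow> p (gen g) \<le> 1"
    and x: "x \<in> free_alg G"
  shows "bdd_above {p x | p. cstar_seminorm G R p}"
proof -
  have word: "p (Poly_Mapping.single (Word ls) 1) \<le> 1"
    if p: "cstar_seminorm G R p" and "fst ` set ls \<subseteq> G" for p and ls :: "('a \<times> bool) list"
    using that(2)
  proof (induction ls)
    case Nil
    have "Poly_Mapping.single (Word []) 1 = (1 :: 'a star_poly)"
      by (simp only: zero_word_def[symmetric] single_one)
    then show ?case using cstar_seminorm_one[OF p] by metis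
  next
    case (Cons l ls)
    obtain y b where l: "l = (y, b)" by force
    let ?l = "Poly_Mapping.single (Word [l]) 1 :: 'a star_poly"
    let ?w = "Poly_Mapping.single (Word ls) 1 :: 'a star_poly"
    have "y \<in> G"
      using Cons.prems l by simp
    moreover have "?l = (if b then adj (gen y) else gen y)"
      unfolding l adj_gen by (simp add: gen_def)
    ultimately have 1: "p ?l \<le> 1"
      using gens[OF p] cstar_seminorm_adj_gen[OF p] by metis
    have free: "?l \<in> free_alg G" "?w \<in> free_alg G"
      using Cons.prems by (simp_all add: free_alg_single)
    have "Poly_Mapping.single (Word (l # ls)) 1 = ?l * ?w"
      by (simp add: mult_single plus_word_def)
    then have "p (Poly_Mapping.single (Word (l # ls)) 1) \<le> p ?l * p ?w"
      using cstar_seminormD(2)[OF p free] by simp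
    also have "\<dots> \<le> 1"
      using 1 Cons.IH Cons.prems cstar_seminorm_nonneg[OF p free(2)] by (intro mult_le_one) simp_all
    finally show ?case .
  qed
  have mono: "p (Poly_Mapping.single w c) \<le> cmod c"
    if p: "cstar_seminorm G R p" and w: "fst ` set (letters w) \<subseteq> G" for p w c
  proof -
    have "Poly_Mapping.single w c = scal c * Poly_Mapping.single w 1"
      by (simp add: scal_def mult_single)
    then have "p (Poly_Mapping.single w c) = cmod c * p (Poly_Mapping.single w 1)"
      using cstar_seminormD(3)[OF p free_alg_single[OF w]] by simp
    also have "\<dots> \<le> cmod c"
      using word[OF p, of "letters w"] w by (simp add: mult_left_le)
    finally show ?thesis .
  qed
  have "p x \<le> (\<Sum>w\<in>Poly_Mapping.keys x. cmod (Poly_Mapping.lookup x w))"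
    if p: "cstar_seminorm G R p" for p
  proof -
    have "p (\<Sum>w\<in>K. Poly_Mapping.single w (Poly_Mapping.lookup x w))
            \<le> (\<Sum>w\<in>K. cmod (Poly_Mapping.lookup x w)) \<and>
          (\<Sum>w\<in>K. Poly_Mapping.single w (Poly_Mapping.lookup x w)) \<in> free_alg G"
      if "finite K" "K \<subseteq> Poly_Mapping.keys x" for K
      using that
    proof (induction K)
      case empty
      then show ?case using cstar_seminorm_zero[OF p] by simp
    next
      case (insert w K)
      have w: "fst ` set (letters w) \<subseteq> G"
        using insert.prems x by (auto simp: free_alg_def)
      let ?m = "Poly_Mapping.single w (Poly_Mapping.lookup x w)"
      let ?y = "\<Sum>w\<in>K. Poly_Mapping.single w (Poly_Mapping.lookup x w)"
      have m: "?m \<in> free_alg G" and y: "?y \<in> free_alg G"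
        and IH: "p ?y \<le> (\<Sum>w\<in>K. cmod (Poly_Mapping.lookup x w))"
        using w insert.IH insert.prems by (auto intro: free_alg_single)
      have "p (?m + ?y) \<le> cmod (Poly_Mapping.lookup x w) + (\<Sum>w\<in>K. cmod (Poly_Mapping.lookup x w))"
        using cstar_seminormD(1)[OF p m y] mono[OF p w, of "Poly_Mapping.lookup x w"] IH by linarith
      then show ?case
        using free_alg_add[OF m y] insert.hyps by (simp only: sum.insert simp_thms)
    qed
    from this[OF finite_keys subset_refl] show ?thesis
      by (simp add: star_poly_monomials)
  qed
  then show ?thesis
    by (auto intro!: bdd_aboveI)
qed

lemma isometry_seminorm_le_1:
  assumes p: "cstar_seminorm G R p" and g: "g \<in> G" and r: "adj (gen g) * gen g - 1 \<in> R"
  shows "p (gen g) \<le> 1"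
proof -
  have "(p (gen g))\<^sup>2 = p ((adj (gen g) * gen g - 1) + 1)"
    using cstar_seminormD(4)[OF p, of "gen g"] g by simp
  also have "\<dots> \<le> p (adj (gen g) * gen g - 1) + p 1"
    using g by (intro cstar_seminormD(1)[OF p] free_alg_diff free_alg_mult) (auto simp: adj_gen_free)
  also have "\<dots> \<le> 1"
    using cstar_seminormD(5)[OF p r] cstar_seminorm_one[OF p] by simp
  finally show ?thesis
    using abs_square_le_1[of "p (gen g)"] by auto
qed

lemma projection_seminorm_le_1:
  assumes p: "cstar_seminorm G R p" and g: "g \<in> G"
    and r: "adj (gen g) - gen g \<in> R" "gen g * gen g - gen g \<in> R"
  shows "p (gen g) \<le> 1"
proof -
  let ?e = "gen g"
  have free: "?e \<in> free_alg G" "adj ?e \<in> free_alg G"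
    using g by (auto simp: adj_gen_free)
  have "p (adj ?e * ?e) = p ((adj ?e - ?e) * ?e + ((?e * ?e - ?e) + ?e))"
    by (simp add: algebra_simps)
  also have "\<dots> \<le> p ((adj ?e - ?e) * ?e) + p ((?e * ?e - ?e) + ?e)"
    using free by (intro cstar_seminormD(1)[OF p] free_alg_add free_alg_diff free_alg_mult)
  also have "\<dots> \<le> p (adj ?e - ?e) * p ?e + (p (?e * ?e - ?e) + p ?e)"
    using free by (intro add_mono cstar_seminormD(1,2)[OF p] free_alg_diff free_alg_mult)
  also have "\<dots> = p ?e"
    using cstar_seminormD(5)[OF p r(1)] cstar_seminormD(5)[OF p r(2)] by simp
  finally have "(p ?e)\<^sup>2 \<le> p ?e"
    using cstar_seminormD(4)[OF p free(1)] by (simp only:)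
  then show ?thesis
    by (rule square_le_self)
qed

lemma QZ_admissible:
  assumes "x \<in> free_alg qz_gens"
  shows "bdd_above {p x | p. cstar_seminorm qz_gens qz_rels p}"
proof (rule bdd_above_seminorms[OF _ assms])
  fix p g assume p: "cstar_seminorm qz_gens qz_rels p" and g: "g \<in> qz_gens"
  then show "p (gen g) \<le> 1"
    by (intro isometry_seminorm_le_1[OF p g]) (auto simp: qz_gens_def qz_rels_def Let_def)
qed

lemma BQ_admissible:
  assumes "x \<in> free_alg (bq_gens P)"
  shows "bdd_above {p x | p. cstar_seminorm (bq_gens P) (bq_rels P) p}"
proof (rule bdd_above_seminorms[OF _ assms])
  fix p g assume p: "cstar_seminorm (bq_gens P) (bq_rels P) p" and g: "g \<in> bq_gens P"
  then consider q where "g = W q" "q \<in> carrier P" | X where "g = E X" "X \<in> constructible_ideals P"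
    by (auto simp: bq_gens_def)
  then show "p (gen g) \<le> 1"
  proof cases
    case 1
    then show ?thesis
      by (intro isometry_seminorm_le_1[OF p g]) (auto simp: bq_rels_def Let_def)
  next
    case 2
    then show ?thesis
      by (intro projection_seminorm_le_1[OF p g]) (auto simp: bq_rels_def Let_def)
  qed
qed

end

theory Submission
  imports Defs
begin

text \<open>The isomorphism comes from matching generators. In the boundary quotient,
  \<open>w\<^bsub>(m,a)\<^esub> = w\<^bsub>(1,1)\<^esub>\<^sup>m w\<^bsub>(0,a)\<^esub>\<close> and \<open>e\<^bsub>pP\<^esub> = w\<^sub>p w\<^sub>p\<^sup>*\<close>, so it is generated by
  \<open>w\<^bsub>(1,1)\<^esub>\<close> and the \<open>w\<^bsub>(0,a)\<^esub>\<close>. Accordingly \<open>s\<close> is sent to \<open>w\<^bsub>(1,1)\<^esub>\<close> and \<open>v\<^sub>a\<close> to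
  \<open>w\<^bsub>(0,a)\<^esub>\<close>, and backwards \<open>w\<^bsub>(m,a)\<^esub>\<close> goes to \<open>s\<^sup>m v\<^sub>a\<close> and \<open>e\<^bsub>pP\<^esub>\<close> to the range projection of
  the image of \<open>w\<^sub>p\<close>. Once each family is known to satisfy the relations of the other algebra, the two
  substitutions are mutually inverse up to elements that every C*-seminorm kills. They then exchange
  the C*-seminorms of the two presentations, hence preserve the universal norms and extend to the
  completions (locale \<open>presentation_iso\<close>).

  The relations of \<open>Q\<^sub>\<int>\<close> hold in the boundary quotient (\<open>qz_relations_w\<close>): the pairs \<open>(j, \<bar>a\<bar>)\<close> with
  \<open>0 \<le> j < \<bar>a\<bar>\<close> form a foundation set whose ideals are disjoint, and for orthogonal projections the
  foundation relation \<open>\<Prod>(1 - e\<^sub>j) = 0\<close> says \<open>\<Sum>e\<^sub>j = 1\<close>.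

  Conversely (\<open>bq_relations_w_e\<close>), fix \<open>N > 0\<close> and write \<open>E\<^sub>x\<close> for the range projection of
  \<open>s\<^sup>x v\<^sub>N\<close>. It depends only on the residue of \<open>x\<close> modulo \<open>N\<close>, and the relation \<open>v_sum\<close> says that the sum
  over all residues is \<open>1\<close>. If \<open>a\<close> divides \<open>N\<close>, then \<open>v_sum\<close> also splits the range projection of \<open>s\<^sup>m v\<^sub>a\<close>
  into those \<open>E\<^sub>x\<close> with \<open>x \<equiv> m\<close> modulo \<open>a\<close>. So finitely many of the projections \<open>e\<^sub>X\<close> are simultaneously
  diagonal over \<open>\<int>/N\<close> for a common multiple \<open>N\<close> of the moduli, and the relations
  \<open>e\<^sub>X e\<^sub>Y = e\<^bsub>X \<inter> Y\<^esub>\<close> and \<open>\<Prod>(1 - e\<^bsub>pP\<^esub>) = 0\<close> become statements about residue classes.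

  The diagonal picture needs the \<open>E\<^sub>x\<close> to be mutually orthogonal. This is where the norm enters: projections
  with sum \<open>1\<close> in a C*-algebra are orthogonal (\<open>sum_projections_orthogonal\<close>). The usual proof rests on
  the positivity of elements \<open>x\<^sup>* x\<close>; here it is replaced by an elementary argument for C*-seminorms,
  which shows that a projection is an extreme point of the self-adjoint unit ball of its corner.\<close>

section \<open>Star-homomorphisms between free star-algebras\<close>

lemma star_poly_induct [case_names single add]:
  fixes x :: "'g star_poly"
  assumes single: "\<And>w c. w \<in> insert 0 (Poly_Mapping.keys x) \<Longrightarrow> P (Poly_Mapping.single w c)"
    and add: "\<And>y z. P y \<Longrightarrow> P z \<Longrightarrow> P (y + z)"
  shows "P x"
proof -
  have "P (\<Sum>w\<in>K. Poly_Mapping.single w (Poly_Mapping.lookup x w))"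
    if "finite K" "K \<subseteq> Poly_Mapping.keys x" for K
    using that
  proof (induction K)
    case empty
    then show ?case using single[of 0 0] by simp
  qed (auto intro: single add)
  from this[OF finite_keys subset_refl] show ?thesis
    by (simp only: star_poly_monomials)
qed

lemma scal_add: "scal (c + d) = scal c + scal d"
  by (simp add: scal_def single_add)

lemma scal_mult: "scal c * scal d = scal (c * d)"
  by (simp add: scal_def mult_single)

lemma scal_0 [simp]: "scal 0 = 0"
  and scal_1 [simp]: "scal 1 = 1"
  by (simp_all add: scal_def)

lemma scal_uminus: "scal (- c) = - scal c"
  by (simp add: scal_def single_uminus)

lemma scal_commute: "x * scal c = scal c * x"
  by (induction x rule: star_poly_induct)
    (simp_all add: scal_def mult_single distrib_left distrib_right mult.commute)

lemma adj_add [simp]: "adj (x + y) = adj x + adj y"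
  unfolding adj_def by (rule setsum_keys_plus_distrib) (simp_all add: single_add)

lemma adj_word_plus: "adj_word (u + v) = adj_word v + adj_word u"
  by (simp add: adj_word_def plus_word_def)

lemma adj_word_adj_word [simp]: "adj_word (adj_word w) = w"
  by (cases w) (simp add: adj_word_def rev_map comp_def case_prod_unfold)

lemma adj_adj [simp]: "adj (adj x) = x"
  by (induction x rule: star_poly_induct) (simp_all add: adj_single)

lemma adj_mult [simp]: "adj (x * y) = adj y * adj x"
proof (induction x rule: star_poly_induct)
  case (single u c)
  show ?case
    by (induction y rule: star_poly_induct)
      (simp_all add: adj_single mult_single adj_word_plus distrib_left distrib_right mult.commute)
qed (simp add: distrib_left distrib_right)

lemma adj_scal [simp]: "adj (scal c) = scal (cnj c)"
  by (simp add: scal_def adj_single adj_word_def zero_word_def)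

lemma adj_0 [simp]: "adj 0 = 0"
  by (simp add: adj_def)

lemma adj_uminus [simp]: "adj (- x) = - adj x"
  using adj_add[of x "- x"] by (simp add: eq_neg_iff_add_eq_0 add.commute)

lemma adj_diff [simp]: "adj (x - y) = adj x - adj y"
  using adj_add[of x "- y"] by simp

lemma free_alg_adj: "x \<in> free_alg G \<Longrightarrow> adj x \<in> free_alg G"
proof -
  assume x: "x \<in> free_alg G"
  have "adj x \<in> free_alg G \<and> x \<in> free_alg G"
  proof (induction x rule: star_poly_induct)
    case (single w c)
    then have "fst ` set (letters w) \<subseteq> G"
      using x by (auto simp: free_alg_def zero_word_def)
    moreover from this have "fst ` set (letters (adj_word w)) \<subseteq> G"
      by (auto simp: adj_word_def image_iff)
    ultimately show ?case
      by (simp add: adj_single free_alg_single)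
  qed (simp add: free_alg_add)
  then show ?thesis ..
qed

lemma free_alg_UNIV [simp]: "free_alg UNIV = UNIV"
  by (simp add: free_alg_def)

lemma free_alg_power: "x \<in> free_alg G \<Longrightarrow> x ^ n \<in> free_alg G"
  by (induction n) (simp_all add: free_alg_mult)

lemma free_alg_sum: "(\<And>i. i \<in> I \<Longrightarrow> f i \<in> free_alg G) \<Longrightarrow> sum f I \<in> free_alg G"
  by (induction I rule: infinite_finite_induct) (simp_all add: free_alg_add)

lemma free_alg_prod_list: "(\<And>x. x \<in> set xs \<Longrightarrow> x \<in> free_alg G) \<Longrightarrow> prod_list xs \<in> free_alg G"
  by (induction xs) (simp_all add: free_alg_mult)

text \<open>The cases are the generators of the free star-algebra; the adjoint of a product is reached through
  its letters, so that closure under adjoints is only asked of generators.\<close>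

lemma free_alg_induct [consumes 1, case_names scal gen adj_gen add mult]:
  assumes x: "x \<in> free_alg G"
    and scal: "\<And>c. P (scal c)"
    and gen: "\<And>g. g \<in> G \<Longrightarrow> P (gen g)"
    and adj_gen: "\<And>g. g \<in> G \<Longrightarrow> P (adj (gen g))"
    and add: "\<And>y z. y \<in> free_alg G \<Longrightarrow> z \<in> free_alg G \<Longrightarrow> P y \<Longrightarrow> P z \<Longrightarrow> P (y + z)"
    and mult: "\<And>y z. y \<in> free_alg G \<Longrightarrow> z \<in> free_alg G \<Longrightarrow> P y \<Longrightarrow> P z \<Longrightarrow> P (y * z)"
  shows "P x"
proof -
  have word: "P (Poly_Mapping.single (Word ls) c)" if "fst ` set ls \<subseteq> G" for ls and c :: complex
    using that
  proof (induction ls)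
    case Nil
    then show ?case using scal[of c] by (simp add: scal_def zero_word_def)
  next
    case (Cons l ls)
    obtain y b where l: "l = (y, b)" by force
    let ?l = "if b then adj (gen y) else gen y"
    have "P ?l" "?l \<in> free_alg G"
      using Cons.prems l by (simp_all add: gen adj_gen adj_gen_free)
    moreover have "Poly_Mapping.single (Word (l # ls)) c = ?l * Poly_Mapping.single (Word ls) c"
      by (simp add: l gen_def adj_single adj_word_def mult_single plus_word_def)
    moreover have "P (Poly_Mapping.single (Word ls) c)" "Poly_Mapping.single (Word ls) c \<in> free_alg G"
      using Cons by (simp_all add: free_alg_single)
    ultimately show ?case
      by (metis mult)
  qed
  have "P x \<and> x \<in> free_alg G"
  proof (induction x rule: star_poly_induct)
    case (single w c)
    then have "fst ` set (letters w) \<subseteq> G"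
      using x by (auto simp: free_alg_def zero_word_def)
    then show ?case
      using word[of "letters w" c] by (simp add: free_alg_single)
  qed (simp add: free_alg_add add)
  then show ?thesis ..
qed

definition letter_val :: "('g \<Rightarrow> 'h star_poly) \<Rightarrow> 'g \<times> bool \<Rightarrow> 'h star_poly" where
  "letter_val f l = (if snd l then adj (f (fst l)) else f (fst l))"

definition word_val :: "('g \<Rightarrow> 'h star_poly) \<Rightarrow> 'g word \<Rightarrow> 'h star_poly" where
  "word_val f w = prod_list (map (letter_val f) (letters w))"

text \<open>The universal property of the free star-algebra: the unital star-homomorphism that extends a map
  given on generators.\<close>

definition subst :: "('g \<Rightarrow> 'h star_poly) \<Rightarrow> 'g star_poly \<Rightarrow> 'h star_poly" where
  "subst f x = (\<Sum>w\<in>Poly_Mapping.keys x. scal (Poly_Mapping.lookup x w) * word_val f w)"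

lemma subst_single: "subst f (Poly_Mapping.single w c) = scal c * word_val f w"
  by (cases "c = 0") (simp_all add: subst_def)

lemma word_val_plus: "word_val f (u + v) = word_val f u * word_val f v"
  by (simp add: word_val_def plus_word_def)

lemma word_val_adj: "word_val f (adj_word w) = adj (word_val f w)"
proof -
  have "prod_list (map (letter_val f) (rev (map (\<lambda>(x, b). (x, \<not> b)) ls)))
      = adj (prod_list (map (letter_val f) ls))" for ls
    by (induction ls) (auto simp: letter_val_def)
  then show ?thesis by (simp add: word_val_def adj_word_def)
qed

lemma subst_add [simp]: "subst f (x + y) = subst f x + subst f y"
  unfolding subst_def by (rule setsum_keys_plus_distrib) (simp_all add: scal_add distrib_right)

lemma subst_mult [simp]: "subst f (x * y) = subst f x * subst f y"
proof (induction x rule: star_poly_induct)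
  case (single u c)
  show ?case
  proof (induction y rule: star_poly_induct)
    case (single v d)
    have "scal (c * d) * (word_val f u * word_val f v)
        = scal c * word_val f u * (scal d * word_val f v)"
      unfolding scal_mult[symmetric] by (metis mult.assoc scal_commute)
    then show ?case
      by (simp add: mult_single subst_single word_val_plus)
  qed (simp add: distrib_left)
qed (simp add: distrib_right)

lemma subst_scal [simp]: "subst f (scal c) = scal c"
  by (simp add: scal_def subst_single) (simp add: scal_def word_val_def zero_word_def)

lemma subst_0 [simp]: "subst f 0 = 0" and subst_1 [simp]: "subst f 1 = 1"
  using subst_scal[of f 0] subst_scal[of f 1] by simp_all

lemma subst_gen [simp]: "subst f (gen x) = f x"
  by (simp add: gen_def subst_single word_val_def letter_val_def)

lemma subst_adj [simp]: "subst f (adj x) = adj (subst f x)"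
  by (induction x rule: star_poly_induct)
    (simp_all add: adj_single subst_single word_val_adj scal_commute)

lemma subst_uminus [simp]: "subst f (- x) = - subst f x"
  using subst_add[of f x "- x"] by (simp add: eq_neg_iff_add_eq_0 add.commute)

lemma subst_diff [simp]: "subst f (x - y) = subst f x - subst f y"
  using subst_add[of f x "- y"] by simp

lemma subst_subst: "subst f (subst g x) = subst (\<lambda>u. subst f (g u)) x"
proof (induction x rule: star_poly_induct)
  case (single w c)
  have "subst f (prod_list (map (letter_val g) ls)) = prod_list (map (letter_val (\<lambda>u. subst f (g u))) ls)" for ls
    by (induction ls) (auto simp: letter_val_def)
  then show ?case by (simp add: subst_single word_val_def)
qed simp

lemma subst_free:
  assumes f: "\<And>g. g \<in> G \<Longrightarrow> f g \<in> free_alg G'" and "x \<in> free_alg G"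
  shows "subst f x \<in> free_alg G'"
  using assms(2) by (induction rule: free_alg_induct) (simp_all add: f free_alg_adj free_alg_add free_alg_mult)

section \<open>The universal norm and classes of Cauchy sequences\<close>

lemma cstar_seminorm_adj:
  assumes p: "cstar_seminorm G R p" and x: "x \<in> free_alg G"
  shows "p (adj x) = p x"
proof -
  have le: "p y \<le> p (adj y)" if y: "y \<in> free_alg G" for y
  proof (cases "p y = 0")
    case True
    then show ?thesis using cstar_seminorm_nonneg[OF p] free_alg_adj[OF y] by simp
  next
    case False
    then have "0 < p y" using cstar_seminorm_nonneg[OF p y] by simp
    moreover have "p y * p y \<le> p (adj y) * p y"
      using cstar_seminormD(2)[OF p free_alg_adj[OF y] y] cstar_seminormD(4)[OF p y]
      by (simp add: power2_eq_square)
    ultimately show ?thesis by simp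
  qed
  show ?thesis
    using le[OF x] le[OF free_alg_adj[OF x]] by simp
qed

lemma free_alg_uminus: "- x \<in> free_alg G \<longleftrightarrow> x \<in> free_alg G"
  by (simp add: free_alg_def)

lemma cstar_seminorm_uminus:
  assumes "cstar_seminorm G R p" "x \<in> free_alg G"
  shows "p (- x) = p x"
  using cstar_seminormD(3)[OF assms, of "- 1"] by (simp add: scal_uminus)

lemma cstar_seminorm_diff:
  assumes p: "cstar_seminorm G R p" and "x \<in> free_alg G" "y \<in> free_alg G"
  shows "p (x - y) \<le> p x + p y"
  using cstar_seminormD(1)[OF p, of x "- y"] cstar_seminorm_uminus[OF p, of y] assms
  by (simp add: free_alg_uminus)

lemma cstar_seminorm_eq:
  assumes p: "cstar_seminorm G R p" and x: "x \<in> free_alg G" and y: "y \<in> free_alg G"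
    and 0: "p (x - y) = 0"
  shows "p x = p y"
proof -
  have "p x \<le> p y"
    using cstar_seminormD(1)[OF p free_alg_diff[OF x y] y] 0 by simp
  moreover have "p y \<le> p x"
    using cstar_seminorm_diff[OF p x free_alg_diff[OF x y]] 0 by simp
  ultimately show ?thesis by simp
qed

lemma cstar_seminorm_subst:
  assumes p: "cstar_seminorm G' R' p" and a: "\<And>g. g \<in> G \<Longrightarrow> a g \<in> free_alg G'"
    and R: "\<And>r. r \<in> R \<Longrightarrow> p (subst a r) = 0"
  shows "cstar_seminorm G R (\<lambda>x. p (subst a x))"
  using cstar_seminormD[OF p] R by (auto simp: cstar_seminorm_def subst_free[of G a G', OF a])

lemma cstar_seminorm_const_0: "cstar_seminorm G R (\<lambda>_. 0)"
  by (simp add: cstar_seminorm_def)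

text \<open>The elements fixed by a star-endomorphism up to a seminorm form a star-subalgebra, so it is
  enough to test generators.\<close>

lemma cstar_seminorm_subst_id:
  assumes p: "cstar_seminorm G R p" and c: "\<And>g. g \<in> G \<Longrightarrow> c g \<in> free_alg G"
    and null: "\<And>g. g \<in> G \<Longrightarrow> p (c g - gen g) = 0" and "x \<in> free_alg G"
  shows "p (subst c x - x) = 0"
  using assms(4)
proof (induction rule: free_alg_induct)
  case (scal k)
  show ?case by (simp add: cstar_seminorm_zero[OF p])
next
  case (gen g)
  then show ?case by (simp add: null)
next
  case (adj_gen g)
  then have "p (adj (c g - gen g)) = 0"
    using cstar_seminorm_adj[OF p, of "c g - gen g"] by (simp add: null c free_alg_diff del: adj_diff)
  then show ?case by simp
next
  case (add y z)
  let ?s = "subst c"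
  have free: "?s y \<in> free_alg G" "?s z \<in> free_alg G"
    using add c by (auto intro: subst_free)
  have "p ((?s y - y) + (?s z - z)) \<le> p (?s y - y) + p (?s z - z)"
    using add free by (intro cstar_seminormD(1)[OF p] free_alg_diff) auto
  moreover have "0 \<le> p ((?s y - y) + (?s z - z))"
    using add free by (intro cstar_seminorm_nonneg[OF p] free_alg_diff free_alg_add) auto
  ultimately show ?case
    using add by (simp add: algebra_simps)
next
  case (mult y z)
  let ?s = "subst c"
  have free: "?s y \<in> free_alg G" "?s z \<in> free_alg G"
    using mult c by (auto intro: subst_free)
  have "p (?s y * (?s z - z) + (?s y - y) * z) \<le> p (?s y * (?s z - z)) + p ((?s y - y) * z)"
    using mult free by (intro cstar_seminormD(1)[OF p] free_alg_diff free_alg_mult) auto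
  also have "\<dots> \<le> p (?s y) * p (?s z - z) + p (?s y - y) * p z"
    using mult free by (intro add_mono cstar_seminormD(2)[OF p] free_alg_diff) auto
  finally have "p (?s y * (?s z - z) + (?s y - y) * z) \<le> 0"
    using mult by simp
  moreover have "0 \<le> p (?s y * (?s z - z) + (?s y - y) * z)"
    using mult free by (intro cstar_seminorm_nonneg[OF p] free_alg_diff free_alg_add free_alg_mult) auto
  ultimately show ?case
    by (simp add: algebra_simps)
qed

locale admissible =
  fixes G :: "'g set" and R :: "'g star_poly set"
  assumes bdd: "x \<in> free_alg G \<Longrightarrow> bdd_above {p x | p. cstar_seminorm G R p}"
begin

abbreviation "nrm \<equiv> univ_norm G R"

lemma nrm_upper: "x \<in> free_alg G \<Longrightarrow> cstar_seminorm G R p \<Longrightarrow> p x \<le> nrm x"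
  unfolding univ_norm_def by (rule cSup_upper[OF _ bdd]) auto

lemma nrm_least: "(\<And>p. cstar_seminorm G R p \<Longrightarrow> p x \<le> c) \<Longrightarrow> nrm x \<le> c"
  unfolding univ_norm_def by (rule cSup_least) (use cstar_seminorm_const_0 in auto)

lemma nrm_nonneg: "x \<in> free_alg G \<Longrightarrow> 0 \<le> nrm x"
  using nrm_upper[OF _ cstar_seminorm_const_0] by simp

lemma nrm_null: "x \<in> free_alg G \<Longrightarrow> (\<And>p. cstar_seminorm G R p \<Longrightarrow> p x = 0) \<Longrightarrow> nrm x = 0"
  by (metis antisym nrm_least nrm_nonneg order_refl)

lemma nrm_add: "x \<in> free_alg G \<Longrightarrow> y \<in> free_alg G \<Longrightarrow> nrm (x + y) \<le> nrm x + nrm y"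
  by (rule nrm_least, rule order_trans[OF cstar_seminormD(1) add_mono]) (auto intro: nrm_upper)

lemma nrm_mult: "x \<in> free_alg G \<Longrightarrow> y \<in> free_alg G \<Longrightarrow> nrm (x * y) \<le> nrm x * nrm y"
  by (rule nrm_least, rule order_trans[OF cstar_seminormD(2) mult_mono])
    (auto intro: nrm_upper nrm_nonneg cstar_seminorm_nonneg)

lemma nrm_adj: "x \<in> free_alg G \<Longrightarrow> nrm (adj x) \<le> nrm x"
  by (rule nrm_least) (simp add: cstar_seminorm_adj nrm_upper)

lemma nrm_0 [simp]: "nrm 0 = 0"
  by (rule nrm_null) (simp_all add: cstar_seminorm_zero)

lemma nrm_minus_commute: "x \<in> free_alg G \<Longrightarrow> y \<in> free_alg G \<Longrightarrow> nrm (x - y) = nrm (y - x)"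
proof -
  have "nrm (x - y) \<le> nrm (y - x)" if "x \<in> free_alg G" "y \<in> free_alg G" for x y
  proof (rule nrm_least)
    fix p assume "cstar_seminorm G R p"
    then show "p (x - y) \<le> nrm (y - x)"
      using cstar_seminorm_uminus[of G R p "y - x"] that by (simp add: nrm_upper free_alg_diff)
  qed
  then show "x \<in> free_alg G \<Longrightarrow> y \<in> free_alg G \<Longrightarrow> nrm (x - y) = nrm (y - x)"
    by (simp add: antisym)
qed

lemma nrm_triangle:
  assumes "x \<in> free_alg G" "y \<in> free_alg G" "z \<in> free_alg G"
  shows "nrm (x - z) \<le> nrm (x - y) + nrm (y - z)"
  using nrm_add[of "x - y" "y - z"] assms by (simp add: free_alg_diff)

lemma nrm_diff_le:
  assumes "x \<in> free_alg G" "y \<in> free_alg G"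
  shows "\<bar>nrm x - nrm y\<bar> \<le> nrm (x - y)"
  using nrm_triangle[of x y 0] nrm_triangle[of y x 0] nrm_minus_commute[of x y] assms by simp

abbreviation "seqs \<equiv> univ_cauchy G R"
abbreviation "rel \<equiv> univ_rel G R"
abbreviation "cls \<equiv> univ_class G R"

lemma seqs_free: "f \<in> seqs \<Longrightarrow> f n \<in> free_alg G"
  by (auto simp: univ_cauchy_def)

lemma seqsD: "f \<in> seqs \<Longrightarrow> 0 < \<epsilon> \<Longrightarrow> \<exists>N. \<forall>m\<ge>N. \<forall>n\<ge>N. nrm (f m - f n) < \<epsilon>"
  by (simp add: univ_cauchy_def)

text \<open>Every operation on Cauchy sequences is Lipschitz on bounded sets. This lemma and the next one turn
  such an estimate into closure of the Cauchy sequences and compatibility with the null relation.\<close>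

lemma seqs_controlled:
  assumes f: "f \<in> seqs" and g: "g \<in> seqs" and h: "\<And>n. h n \<in> free_alg G" and C: "0 < C"
    and le: "\<And>m n. nrm (h m - h n) \<le> C * nrm (f m - f n) + C * nrm (g m - g n)"
  shows "h \<in> seqs"
proof -
  have "\<exists>N. \<forall>m\<ge>N. \<forall>n\<ge>N. nrm (h m - h n) < \<epsilon>" if e: "0 < \<epsilon>" for \<epsilon>
  proof -
    have e': "0 < \<epsilon> / (2 * C)" using e C by simp
    obtain M where M: "\<forall>m\<ge>M. \<forall>n\<ge>M. nrm (f m - f n) < \<epsilon> / (2 * C)"
      using seqsD[OF f e'] by blast
    obtain N where N: "\<forall>m\<ge>N. \<forall>n\<ge>N. nrm (g m - g n) < \<epsilon> / (2 * C)"
      using seqsD[OF g e'] by blast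
    have "nrm (h m - h n) < \<epsilon>" if "m \<ge> max M N" "n \<ge> max M N" for m n
    proof -
      have "nrm (h m - h n) \<le> C * nrm (f m - f n) + C * nrm (g m - g n)" by (rule le)
      also have "\<dots> < C * (\<epsilon> / (2 * C)) + C * (\<epsilon> / (2 * C))"
        using M N that C by (intro add_strict_mono mult_strict_left_mono) auto
      also have "\<dots> = \<epsilon>" using C by (simp add: field_simps)
      finally show ?thesis .
    qed
    then show ?thesis by blast
  qed
  then show ?thesis using h by (auto simp: univ_cauchy_def)
qed

lemma rel_controlled:
  assumes f: "(f, f') \<in> rel" and g: "(g, g') \<in> rel" and h: "h \<in> seqs" "h' \<in> seqs"
    and le: "\<And>n. nrm (h n - h' n) \<le> C * nrm (f n - f' n) + C * nrm (g n - g' n)"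
  shows "(h, h') \<in> rel"
proof -
  have "(\<lambda>n. C * nrm (f n - f' n) + C * nrm (g n - g' n)) \<longlonglongrightarrow> C * 0 + C * 0"
    using f g by (intro tendsto_intros) (auto simp: univ_rel_def)
  then have lim: "(\<lambda>n. C * nrm (f n - f' n) + C * nrm (g n - g' n)) \<longlonglongrightarrow> 0" by simp
  have "(\<lambda>n. nrm (h n - h' n)) \<longlonglongrightarrow> 0"
  proof (rule tendsto_sandwich[OF _ _ tendsto_const lim])
    show "\<forall>\<^sub>F n in sequentially. 0 \<le> nrm (h n - h' n)"
      using h by (intro always_eventually allI nrm_nonneg free_alg_diff seqs_free)
    show "\<forall>\<^sub>F n in sequentially. nrm (h n - h' n) \<le> C * nrm (f n - f' n) + C * nrm (g n - g' n)"
      using le by (intro always_eventually allI)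
  qed
  then show ?thesis using h by (simp add: univ_rel_def)
qed

lemma rel_refl: "f \<in> seqs \<Longrightarrow> (f, f) \<in> rel"
  by (simp add: univ_rel_def)

lemma rel_seqs: "(f, g) \<in> rel \<Longrightarrow> f \<in> seqs \<and> g \<in> seqs"
  by (simp add: univ_rel_def)

lemma rel_sym: "(f, g) \<in> rel \<Longrightarrow> (g, f) \<in> rel"
  using nrm_minus_commute seqs_free by (simp add: univ_rel_def)

lemma rel_trans: "(f, g) \<in> rel \<Longrightarrow> (g, h) \<in> rel \<Longrightarrow> (f, h) \<in> rel"
  by (rule rel_controlled[where C = 1 and f = f and f' = g and g = g and g' = h])
    (auto dest!: rel_seqs intro!: nrm_triangle seqs_free)

lemma equiv_rel: "equiv seqs rel"
proof (rule equivI)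
  show "rel \<subseteq> seqs \<times> seqs" by (auto dest: rel_seqs)
  show "refl_on seqs rel" by (auto simp: refl_on_def intro: rel_refl)
  show "sym rel" by (rule symI) (rule rel_sym)
  show "trans rel" by (rule transI) (rule rel_trans)
qed

lemma cls_eq_iff: "f \<in> seqs \<Longrightarrow> g \<in> seqs \<Longrightarrow> cls f = cls g \<longleftrightarrow> (f, g) \<in> rel"
  unfolding univ_class_def by (rule eq_equiv_class_iff[OF equiv_rel])

lemma seqs_const: "x \<in> free_alg G \<Longrightarrow> (\<lambda>_. x) \<in> seqs"
  by (auto simp: univ_cauchy_def)

lemma rel_null:
  assumes "f \<in> seqs" "g \<in> seqs" "\<And>n. nrm (f n - g n) = 0"
  shows "(f, g) \<in> rel"
  using assms by (simp add: univ_rel_def)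

lemma seqs_bounded:
  assumes f: "f \<in> seqs"
  shows "\<exists>B>0. \<forall>n. nrm (f n) \<le> B"
proof -
  obtain N where N: "\<forall>m\<ge>N. \<forall>n\<ge>N. nrm (f m - f n) < 1"
    using seqsD[OF f zero_less_one] by blast
  define B where "B = Max ((\<lambda>n. nrm (f n)) ` {..N}) + 1"
  have le: "nrm (f n) \<le> B - 1" if "n \<le> N" for n
    unfolding B_def using that by (simp add: Max_ge)
  have "nrm (f n) \<le> B" for n
  proof (cases "n \<le> N")
    case False
    then have "nrm (f n - f N) < 1" using N by simp
    moreover have "nrm (f n) \<le> nrm (f n - f N) + nrm (f N)"
      using nrm_add[of "f n - f N" "f N"] seqs_free[OF f] by (simp add: free_alg_diff)
    ultimately show ?thesis using le[of N] by simp
  qed (use le[of n] in simp)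
  moreover have "0 < B"
    using le[of N] nrm_nonneg[of "f N"] seqs_free[OF f] by force
  ultimately show ?thesis by blast
qed

lemma seqs_add: "f \<in> seqs \<Longrightarrow> g \<in> seqs \<Longrightarrow> (\<lambda>n. f n + g n) \<in> seqs"
proof (rule seqs_controlled[where f = f and g = g and C = 1])
  fix m n assume "f \<in> seqs" "g \<in> seqs"
  then show "nrm (f m + g m - (f n + g n)) \<le> 1 * nrm (f m - f n) + 1 * nrm (g m - g n)"
    using nrm_add[of "f m - f n" "g m - g n"] by (simp add: seqs_free free_alg_diff algebra_simps)
qed (auto simp: seqs_free free_alg_add)

lemma rel_add: "(f, f') \<in> rel \<Longrightarrow> (g, g') \<in> rel \<Longrightarrow> ((\<lambda>n. f n + g n), (\<lambda>n. f' n + g' n)) \<in> rel"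
proof (rule rel_controlled[where f = f and f' = f' and g = g and g' = g' and C = 1])
  fix n assume "(f, f') \<in> rel" "(g, g') \<in> rel"
  then show "nrm (f n + g n - (f' n + g' n)) \<le> 1 * nrm (f n - f' n) + 1 * nrm (g n - g' n)"
    using nrm_add[of "f n - f' n" "g n - g' n"]
    by (auto dest!: rel_seqs simp: seqs_free free_alg_diff algebra_simps)
qed (auto dest: rel_seqs intro: seqs_add)

lemma nrm_mult_diff:
  assumes free: "x \<in> free_alg G" "y \<in> free_alg G" "x' \<in> free_alg G" "y' \<in> free_alg G"
    and B: "nrm y \<le> B" "nrm x' \<le> B"
  shows "nrm (x * y - x' * y') \<le> B * nrm (x - x') + B * nrm (y - y')"
proof -
  have "nrm (x * y - x' * y') = nrm ((x - x') * y + x' * (y - y'))"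
    by (simp add: algebra_simps)
  also have "\<dots> \<le> nrm ((x - x') * y) + nrm (x' * (y - y'))"
    using free by (intro nrm_add free_alg_mult free_alg_diff)
  also have "\<dots> \<le> nrm (x - x') * nrm y + nrm x' * nrm (y - y')"
    using free by (intro add_mono nrm_mult free_alg_diff)
  also have "\<dots> \<le> nrm (x - x') * B + B * nrm (y - y')"
    using free B by (intro add_mono mult_left_mono mult_right_mono nrm_nonneg free_alg_diff)
  finally show ?thesis by (simp add: mult.commute)
qed

lemma seqs_mult: "f \<in> seqs \<Longrightarrow> g \<in> seqs \<Longrightarrow> (\<lambda>n. f n * g n) \<in> seqs"
proof -
  assume f: "f \<in> seqs" and g: "g \<in> seqs"
  obtain B where B: "B > 0" "\<And>n. nrm (f n) \<le> B" using seqs_bounded[OF f] by blast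
  obtain C where C: "C > 0" "\<And>n. nrm (g n) \<le> C" using seqs_bounded[OF g] by blast
  show ?thesis
  proof (rule seqs_controlled[OF f g, where C = "max B C"])
    fix m n
    show "nrm (f m * g m - f n * g n) \<le> max B C * nrm (f m - f n) + max B C * nrm (g m - g n)"
      using B C f g by (intro nrm_mult_diff) (auto simp: seqs_free max.coboundedI1 max.coboundedI2)
  qed (use B f g in \<open>auto simp: seqs_free free_alg_mult less_max_iff_disj\<close>)
qed

lemma rel_mult:
  assumes fg: "(f, f') \<in> rel" "(g, g') \<in> rel"
  shows "((\<lambda>n. f n * g n), (\<lambda>n. f' n * g' n)) \<in> rel"
proof -
  note seqs = fg[THEN rel_seqs]
  obtain B where B: "B > 0" "\<And>n. nrm (f' n) \<le> B" using seqs_bounded[of f'] seqs by blast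
  obtain C where C: "C > 0" "\<And>n. nrm (g n) \<le> C" using seqs_bounded[of g] seqs by blast
  show ?thesis
  proof (rule rel_controlled[OF fg, where C = "max B C"])
    fix n
    show "nrm (f n * g n - f' n * g' n) \<le> max B C * nrm (f n - f' n) + max B C * nrm (g n - g' n)"
      using B C seqs by (intro nrm_mult_diff) (auto simp: seqs_free max.coboundedI1 max.coboundedI2)
  qed (use seqs in \<open>auto intro: seqs_mult\<close>)
qed

lemma seqs_scal: "f \<in> seqs \<Longrightarrow> (\<lambda>n. scal c * f n) \<in> seqs"
  using seqs_mult[OF seqs_const[of "scal c"]] by simp

lemma rel_scal: "(f, f') \<in> rel \<Longrightarrow> ((\<lambda>n. scal c * f n), (\<lambda>n. scal c * f' n)) \<in> rel"
  using rel_mult[OF rel_refl[OF seqs_const[of "scal c"]]] by simp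

lemma seqs_adj: "f \<in> seqs \<Longrightarrow> (\<lambda>n. adj (f n)) \<in> seqs"
proof (rule seqs_controlled[where f = f and g = f and C = 1])
  fix m n assume f: "f \<in> seqs"
  then show "nrm (adj (f m) - adj (f n)) \<le> 1 * nrm (f m - f n) + 1 * nrm (f m - f n)"
    using nrm_adj[of "f m - f n"] nrm_nonneg[of "f m - f n"] by (simp add: seqs_free free_alg_diff)
qed (auto simp: seqs_free free_alg_adj)

lemma rel_adj: "(f, f') \<in> rel \<Longrightarrow> ((\<lambda>n. adj (f n)), (\<lambda>n. adj (f' n))) \<in> rel"
proof (rule rel_controlled[where f = f and f' = f' and g = f and g' = f' and C = 1])
  fix n assume "(f, f') \<in> rel"
  then show "nrm (adj (f n) - adj (f' n)) \<le> 1 * nrm (f n - f' n) + 1 * nrm (f n - f' n)"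
    using nrm_adj[of "f n - f' n"] nrm_nonneg[of "f n - f' n"]
    by (auto dest!: rel_seqs simp: seqs_free free_alg_diff)
qed (auto dest: rel_seqs intro: seqs_adj)

lemma cls_eqI: "(f, g) \<in> rel \<Longrightarrow> cls f = cls g"
  unfolding univ_class_def by (rule equiv_class_eq[OF equiv_rel])

text \<open>The operations on the completion are unions over representatives; for a class function the union
  collapses to its value at any one of them.\<close>

lemma UN_cls:
  assumes f: "f \<in> seqs" and T: "\<And>f'. (f, f') \<in> rel \<Longrightarrow> T f' = T f"
  shows "(\<Union>f'\<in>cls f. T f') = T f"
proof -
  have "f \<in> cls f" using rel_refl[OF f] by (simp add: univ_class_def)
  moreover have "T f' = T f" if "f' \<in> cls f" for f'
    using that by (intro T) (simp add: univ_class_def)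
  ultimately show ?thesis by blast
qed

lemma cls_mult:
  assumes f: "f \<in> seqs" and g: "g \<in> seqs"
  shows "mult (univ_cstar G R) (cls f) (cls g) = cls (\<lambda>n. f n * g n)"
proof -
  let ?T = "\<lambda>f'. \<Union>g'\<in>cls g. cls (\<lambda>n. f' n * g' n)"
  have T: "?T f' = cls (\<lambda>n. f' n * g n)" if "f' \<in> seqs" for f'
    by (rule UN_cls[OF g, where T = "\<lambda>g'. cls (\<lambda>n. f' n * g' n)"])
      (rule cls_eqI[OF rel_sym[OF rel_mult[OF rel_refl[OF that]]]])
  have "(\<Union>f'\<in>cls f. ?T f') = ?T f"
  proof (rule UN_cls[OF f, where T = ?T])
    fix f' assume ff': "(f, f') \<in> rel"
    then have f': "f' \<in> seqs" by (simp add: rel_seqs)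
    show "?T f' = ?T f"
      unfolding T[OF f] T[OF f'] by (rule cls_eqI[OF rel_mult[OF rel_sym[OF ff'] rel_refl[OF g]]])
  qed
  then show ?thesis by (simp add: univ_cstar_def T[OF f])
qed

lemma cls_add:
  assumes f: "f \<in> seqs" and g: "g \<in> seqs"
  shows "add (univ_cstar G R) (cls f) (cls g) = cls (\<lambda>n. f n + g n)"
proof -
  let ?T = "\<lambda>f'. \<Union>g'\<in>cls g. cls (\<lambda>n. f' n + g' n)"
  have T: "?T f' = cls (\<lambda>n. f' n + g n)" if "f' \<in> seqs" for f'
    by (rule UN_cls[OF g, where T = "\<lambda>g'. cls (\<lambda>n. f' n + g' n)"])
      (rule cls_eqI[OF rel_sym[OF rel_add[OF rel_refl[OF that]]]])
  have "(\<Union>f'\<in>cls f. ?T f') = ?T f"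
  proof (rule UN_cls[OF f, where T = ?T])
    fix f' assume ff': "(f, f') \<in> rel"
    then have f': "f' \<in> seqs" by (simp add: rel_seqs)
    show "?T f' = ?T f"
      unfolding T[OF f] T[OF f'] by (rule cls_eqI[OF rel_add[OF rel_sym[OF ff'] rel_refl[OF g]]])
  qed
  then show ?thesis by (simp add: univ_cstar_def T[OF f])
qed

lemma cls_smult:
  assumes f: "f \<in> seqs"
  shows "smult (univ_cstar G R) c (cls f) = cls (\<lambda>n. scal c * (f n))"
proof -
  have "(\<Union>f'\<in>cls f. cls (\<lambda>n. scal c * (f' n))) = cls (\<lambda>n. scal c * (f n))"
    by (rule UN_cls[OF f, where T = "\<lambda>f'. cls (\<lambda>n. scal c * (f' n))"]) (rule cls_eqI[OF rel_sym[OF rel_scal]])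
  then show ?thesis by (simp add: univ_cstar_def)
qed

lemma cls_star:
  assumes f: "f \<in> seqs"
  shows "star (univ_cstar G R) (cls f) = cls (\<lambda>n. adj (f n))"
proof -
  have "cls (\<lambda>n. adj (f' n)) = cls (\<lambda>n. adj (f n))" if ff': "(f, f') \<in> rel" for f'
    by (rule cls_eqI[OF rel_sym[OF rel_adj[OF ff']]])
  then have "(\<Union>f'\<in>cls f. cls (\<lambda>n. adj (f' n))) = cls (\<lambda>n. adj (f n))"
    by (rule UN_cls[OF f, where T = "\<lambda>f'. cls (\<lambda>n. adj (f' n))"])
  then show ?thesis
    by (simp only: univ_cstar_def cstar_struct.select_convs)
qed

lemma cnorm_univ_cstar: "cnorm (univ_cstar G R) X = lim (\<lambda>n. nrm ((SOME f. f \<in> X) n))"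
  by (simp only: univ_cstar_def cstar_struct.select_convs)

text \<open>The norm of a class is defined through an arbitrary representative; all representatives give
  norm sequences with the same limit.\<close>

lemma cls_norm:
  assumes f: "f \<in> seqs"
  shows "(\<lambda>n. nrm (f n)) \<longlonglongrightarrow> cnorm (univ_cstar G R) (cls f)"
proof -
  define g where "g = (SOME g. g \<in> cls f)"
  have "g \<in> cls f"
    unfolding g_def by (rule someI[of _ f]) (simp add: univ_class_def rel_refl[OF f])
  then have fg: "(f, g) \<in> rel" by (simp add: univ_class_def)
  have "Cauchy (\<lambda>n. nrm (f n))"
  proof (rule metric_CauchyI)
    fix e :: real assume e: "0 < e"
    obtain N where N: "\<forall>m\<ge>N. \<forall>n\<ge>N. nrm (f m - f n) < e"
      using seqsD[OF f e] by (rule exE)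
    have "dist (nrm (f m)) (nrm (f n)) < e" if "m \<ge> N" "n \<ge> N" for m n
    proof -
      have "dist (nrm (f m)) (nrm (f n)) \<le> nrm (f m - f n)"
        unfolding dist_real_def by (intro nrm_diff_le seqs_free f)
      also have "\<dots> < e" using N that by blast
      finally show ?thesis .
    qed
    then show "\<exists>M. \<forall>m\<ge>M. \<forall>n\<ge>M. dist (nrm (f m)) (nrm (f n)) < e"
      by (intro exI[of _ N] allI impI)
  qed
  then obtain L where L: "(\<lambda>n. nrm (f n)) \<longlonglongrightarrow> L"
    unfolding Cauchy_convergent_iff convergent_def by (rule exE)
  have "(\<lambda>n. nrm (g n) - nrm (f n)) \<longlonglongrightarrow> 0"
  proof (rule tendsto_rabs_zero_cancel, rule tendsto_sandwich[OF _ _ tendsto_const])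
    show "(\<lambda>n. nrm (f n - g n)) \<longlonglongrightarrow> 0" using fg by (simp add: univ_rel_def)
    have "\<bar>nrm (g n) - nrm (f n)\<bar> \<le> nrm (f n - g n)" for n
    proof -
      have "f n \<in> free_alg G" "g n \<in> free_alg G"
        using rel_seqs[OF fg] by (auto intro: seqs_free)
      from nrm_diff_le[OF this] show ?thesis by (simp add: abs_minus_commute)
    qed
    then show "\<forall>\<^sub>F n in sequentially. \<bar>nrm (g n) - nrm (f n)\<bar> \<le> nrm (f n - g n)"
      by (rule always_eventually[OF allI])
  qed simp
  from tendsto_add[OF this L] have "(\<lambda>n. nrm (g n)) \<longlonglongrightarrow> L" by simp
  then have "lim (\<lambda>n. nrm (g n)) = L" by (rule limI)
  then have "cnorm (univ_cstar G R) (cls f) = L"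
    unfolding cnorm_univ_cstar g_def .
  then show ?thesis using L by (simp only:)
qed

lemma carrier_cls: "X \<in> carrier (univ_cstar G R) \<longleftrightarrow> (\<exists>f\<in>seqs. X = cls f)"
  by (simp add: univ_cstar_def univ_class_def quotient_def)

end

section \<open>Isomorphisms between universal C*-algebras\<close>

text \<open>Two presentations whose generators can be expressed in each other, compatibly with the relations,
  where all identities hold up to elements on which every C*-seminorm of the presentation vanishes.\<close>

locale presentation_iso =
  src: admissible G R + tgt: admissible G' R'
  for G :: "'g set" and R and G' :: "'h set" and R' +
  fixes a :: "'g \<Rightarrow> 'h star_poly" and b :: "'h \<Rightarrow> 'g star_poly"
  assumes a_free: "g \<in> G \<Longrightarrow> a g \<in> free_alg G'"
    and b_free: "h \<in> G' \<Longrightarrow> b h \<in> free_alg G"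
    and a_rels: "cstar_seminorm G' R' q \<Longrightarrow> r \<in> R \<Longrightarrow> q (subst a r) = 0"
    and b_rels: "cstar_seminorm G R p \<Longrightarrow> r' \<in> R' \<Longrightarrow> p (subst b r') = 0"
    and ba: "cstar_seminorm G R p \<Longrightarrow> g \<in> G \<Longrightarrow> p (subst b (a g) - gen g) = 0"
    and ab: "cstar_seminorm G' R' q \<Longrightarrow> h \<in> G' \<Longrightarrow> q (subst a (b h) - gen h) = 0"
begin

lemma subst_a_free: "x \<in> free_alg G \<Longrightarrow> subst a x \<in> free_alg G'"
  by (rule subst_free[OF a_free])

lemma subst_b_free: "y \<in> free_alg G' \<Longrightarrow> subst b y \<in> free_alg G"
  by (rule subst_free[OF b_free])

lemma subst_ba: "cstar_seminorm G R p \<Longrightarrow> x \<in> free_alg G \<Longrightarrow> p (subst b (subst a x) - x) = 0"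
  unfolding subst_subst using cstar_seminorm_subst_id[of G R p "\<lambda>g. subst b (a g)" x] ba
  by (auto simp: subst_b_free a_free)

lemma subst_ab: "cstar_seminorm G' R' q \<Longrightarrow> y \<in> free_alg G' \<Longrightarrow> q (subst a (subst b y) - y) = 0"
  unfolding subst_subst using cstar_seminorm_subst_id[of G' R' q "\<lambda>h. subst a (b h)" y] ab
  by (auto simp: subst_a_free b_free)

text \<open>C*-seminorms pull back along both substitutions, and pulling back twice changes nothing on the
  algebra of the generators. So the two suprema range over the same values.\<close>

lemma nrm_subst:
  assumes x: "x \<in> free_alg G"
  shows "tgt.nrm (subst a x) = src.nrm x"
proof (rule antisym)
  show "tgt.nrm (subst a x) \<le> src.nrm x"
  proof (rule tgt.nrm_least)
    fix q assume q: "cstar_seminorm G' R' q"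
    show "q (subst a x) \<le> src.nrm x"
      using src.nrm_upper[OF x cstar_seminorm_subst[OF q a_free a_rels[OF q]]] .
  qed
  show "src.nrm x \<le> tgt.nrm (subst a x)"
  proof (rule src.nrm_least)
    fix p assume p: "cstar_seminorm G R p"
    have "p x = p (subst b (subst a x))"
      using cstar_seminorm_eq[OF p _ x subst_ba[OF p x]] subst_a_free[OF x] subst_b_free by simp
    also have "\<dots> \<le> tgt.nrm (subst a x)"
      using tgt.nrm_upper[OF subst_a_free[OF x] cstar_seminorm_subst[OF p b_free b_rels[OF p]]] .
    finally show "p x \<le> tgt.nrm (subst a x)" .
  qed
qed

lemma nrm_subst_diff: "x \<in> free_alg G \<Longrightarrow> y \<in> free_alg G \<Longrightarrow> tgt.nrm (subst a x - subst a y) = src.nrm (x - y)"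
  using nrm_subst[of "x - y"] by (simp add: free_alg_diff)

lemma seqs_subst: "f \<in> src.seqs \<Longrightarrow> (\<lambda>n. subst a (f n)) \<in> tgt.seqs"
  using src.seqs_free[of f] unfolding univ_cauchy_def
  by (auto simp: nrm_subst_diff subst_a_free)

lemma rel_subst: "(f, g) \<in> src.rel \<longleftrightarrow> ((\<lambda>n. subst a (f n)), (\<lambda>n. subst a (g n))) \<in> tgt.rel"
  if "f \<in> src.seqs" "g \<in> src.seqs"
  using that src.seqs_free[OF that(1)] src.seqs_free[OF that(2)]
  by (simp add: univ_rel_def seqs_subst nrm_subst_diff)

lemma nrm_subst_b_diff:
  assumes y: "y \<in> free_alg G'" and z: "z \<in> free_alg G'"
  shows "src.nrm (subst b y - subst b z) = tgt.nrm (y - z)"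
proof -
  interpret flip: presentation_iso G' R' G R b a
    by unfold_locales (fact b_free a_free a_rels b_rels ba ab)+
  show ?thesis by (rule flip.nrm_subst_diff[OF y z])
qed

lemma seqs_subst_b: "g \<in> tgt.seqs \<Longrightarrow> (\<lambda>n. subst b (g n)) \<in> src.seqs"
  using tgt.seqs_free[of g] unfolding univ_cauchy_def
  by (auto simp: nrm_subst_b_diff subst_b_free)

lemma rel_subst_ab:
  assumes g: "g \<in> tgt.seqs"
  shows "((\<lambda>n. subst a (subst b (g n))), g) \<in> tgt.rel"
  using g subst_ab tgt.seqs_free[OF g]
  by (intro tgt.rel_null tgt.nrm_null seqs_subst seqs_subst_b free_alg_diff subst_a_free subst_b_free) auto

definition induced :: "(nat \<Rightarrow> 'g star_poly) set \<Rightarrow> (nat \<Rightarrow> 'h star_poly) set" where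
  "induced X = (\<Union>f\<in>X. tgt.cls (\<lambda>n. subst a (f n)))"

lemma induced_cls:
  assumes f: "f \<in> src.seqs"
  shows "induced (src.cls f) = tgt.cls (\<lambda>n. subst a (f n))"
  unfolding induced_def
proof (rule src.UN_cls[OF f, where T = "\<lambda>f'. tgt.cls (\<lambda>n. subst a (f' n))"])
  fix f' assume ff': "(f, f') \<in> src.rel"
  then have "f' \<in> src.seqs" by (simp add: src.rel_seqs)
  then show "tgt.cls (\<lambda>n. subst a (f' n)) = tgt.cls (\<lambda>n. subst a (f n))"
    using rel_subst[OF f, of f'] ff' by (intro tgt.cls_eqI[OF tgt.rel_sym]) simp
qed

theorem induced_iso: "induced \<in> cstar_iso (univ_cstar G R) (univ_cstar G' R')"
proof -
  let ?A = "univ_cstar G R" and ?B = "univ_cstar G' R'"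
  have cls_A: "src.cls f \<in> carrier ?A" if "f \<in> src.seqs" for f
    using that by (auto simp: src.carrier_cls)
  have cls_B: "tgt.cls f \<in> carrier ?B" if "f \<in> tgt.seqs" for f
    using that by (auto simp: tgt.carrier_cls)
  have "induced \<in> ring_hom ?A ?B"
  proof (rule ring_hom_memI)
    fix X Y assume X: "X \<in> carrier ?A" and Y: "Y \<in> carrier ?A"
    obtain f g where f: "f \<in> src.seqs" "X = src.cls f" and g: "g \<in> src.seqs" "Y = src.cls g"
      using X Y src.carrier_cls by auto
    show "induced X \<in> carrier ?B"
      using f by (simp add: induced_cls cls_B seqs_subst)
    show "induced (X \<otimes>\<^bsub>?A\<^esub> Y) = induced X \<otimes>\<^bsub>?B\<^esub> induced Y"
      using f(1) g(1) unfolding f(2) g(2)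
      by (simp add: src.cls_mult tgt.cls_mult induced_cls src.seqs_mult seqs_subst)
    show "induced (X \<oplus>\<^bsub>?A\<^esub> Y) = induced X \<oplus>\<^bsub>?B\<^esub> induced Y"
      using f(1) g(1) unfolding f(2) g(2)
      by (simp add: src.cls_add tgt.cls_add induced_cls src.seqs_add seqs_subst)
  next
    have "\<one>\<^bsub>?A\<^esub> = src.cls (\<lambda>_. 1)" "\<one>\<^bsub>?B\<^esub> = tgt.cls (\<lambda>_. 1)"
      by (simp_all add: univ_cstar_def)
    then show "induced \<one>\<^bsub>?A\<^esub> = \<one>\<^bsub>?B\<^esub>"
      by (simp add: induced_cls src.seqs_const)
  qed
  moreover have "bij_betw induced (carrier ?A) (carrier ?B)"
  proof (rule bij_betw_imageI)
    show "inj_on induced (carrier ?A)"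
    proof (rule inj_onI)
      fix X Y assume "X \<in> carrier ?A" "Y \<in> carrier ?A" and eq: "induced X = induced Y"
      then obtain f g where f: "f \<in> src.seqs" "X = src.cls f" and g: "g \<in> src.seqs" "Y = src.cls g"
        using src.carrier_cls by auto
      have "((\<lambda>n. subst a (f n)), (\<lambda>n. subst a (g n))) \<in> tgt.rel"
        using eq f g tgt.cls_eq_iff[OF seqs_subst seqs_subst] by (simp add: induced_cls)
      then show "X = Y"
        using f g rel_subst src.cls_eqI by simp
    qed
    show "induced ` carrier ?A = carrier ?B"
    proof
      show "induced ` carrier ?A \<subseteq> carrier ?B"
        by (auto simp: src.carrier_cls induced_cls intro!: cls_B seqs_subst)
      show "carrier ?B \<subseteq> induced ` carrier ?A"
      proof
        fix Y assume "Y \<in> carrier ?B"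
        then obtain g where g: "g \<in> tgt.seqs" "Y = tgt.cls g"
          by (auto simp: tgt.carrier_cls)
        then have "Y = induced (src.cls (\<lambda>n. subst b (g n)))"
          using tgt.cls_eqI[OF rel_subst_ab] by (simp add: induced_cls seqs_subst_b)
        then show "Y \<in> induced ` carrier ?A"
          using cls_A[OF seqs_subst_b[OF g(1)]] by (rule image_eqI)
      qed
    qed
  qed
  moreover have "induced (c \<odot>\<^bsub>?A\<^esub> X) = c \<odot>\<^bsub>?B\<^esub> induced X \<and> induced (star ?A X) = star ?B (induced X)
      \<and> cnorm ?B (induced X) = cnorm ?A X" if X: "X \<in> carrier ?A" for X c
  proof -
    obtain f where f: "f \<in> src.seqs" "X = src.cls f"
      using X by (auto simp: src.carrier_cls)
    have "(\<lambda>n. src.nrm (f n)) \<longlonglongrightarrow> cnorm ?B (induced X)"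
      using tgt.cls_norm[OF seqs_subst[OF f(1)]] src.seqs_free[OF f(1)]
      by (simp only: nrm_subst induced_cls[OF f(1)] f(2))
    then have "cnorm ?B (induced X) = cnorm ?A X"
      using LIMSEQ_unique src.cls_norm[OF f(1)] f(2) by blast
    then show ?thesis
      using f(1) unfolding f(2)
      by (simp add: src.cls_smult tgt.cls_smult src.cls_star tgt.cls_star induced_cls
          src.seqs_scal src.seqs_adj seqs_subst)
  qed
  ultimately show ?thesis
    by (auto simp: cstar_iso_def ring_iso_def)
qed

end

section \<open>Projections with sum one are orthogonal\<close>

text \<open>A ring with unit and involution. Since \<^class>\<open>ring_1\<close> includes \<open>0 \<noteq> 1\<close>, which for the algebra of a
  presentation means that it has a nonzero C*-seminorm, the unit comes from \<^class>\<open>monoid_mult\<close>.\<close>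

class star_ring = ring + monoid_mult +
  fixes adjoint :: "'a \<Rightarrow> 'a"
  assumes adjoint_add [simp]: "adjoint (x + y) = adjoint x + adjoint y"
    and adjoint_mult [simp]: "adjoint (x * y) = adjoint y * adjoint x"
    and adjoint_adjoint [simp]: "adjoint (adjoint x) = x"
begin

lemma adjoint_0 [simp]: "adjoint 0 = 0"
  using adjoint_add[of 0 0] by simp

lemma adjoint_uminus [simp]: "adjoint (- x) = - adjoint x"
  using adjoint_add[of x "- x"] by (simp add: eq_neg_iff_add_eq_0 add.commute)

lemma adjoint_diff [simp]: "adjoint (x - y) = adjoint x - adjoint y"
  using adjoint_add[of x "- y"] by simp

lemma adjoint_1 [simp]: "adjoint 1 = 1"
  by (metis adjoint_adjoint adjoint_mult mult_1_right mult_1_left)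

definition projection :: "'a \<Rightarrow> bool" where
  "projection x \<longleftrightarrow> adjoint x = x \<and> x * x = x"

end

lemma adjoint_power: "adjoint (x ^ n) = adjoint (x :: 'a::star_ring) ^ n"
  by (induction n) (simp_all add: power_commutes)

locale cstar_seminorm_ring =
  fixes q :: "'a::star_ring \<Rightarrow> real" and scalar :: "complex \<Rightarrow> 'a"
  assumes scalar_add: "scalar (c + d) = scalar c + scalar d"
    and scalar_mult: "scalar (c * d) = scalar c * scalar d"
    and scalar_1 [simp]: "scalar 1 = 1"
    and scalar_commute: "x * scalar c = scalar c * x"
    and adjoint_scalar [simp]: "adjoint (scalar c) = scalar (cnj c)"
    and q_add: "q (x + y) \<le> q x + q y"
    and q_mult: "q (x * y) \<le> q x * q y"
    and q_scalar: "q (scalar c * x) = cmod c * q x"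
    and q_star: "q (adjoint x * x) = (q x)\<^sup>2"
begin

lemma scalar_0 [simp]: "scalar 0 = 0"
  using scalar_add[of 0 0] by simp

lemma scalar_uminus: "scalar (- c) = - scalar c"
  using scalar_add[of c "- c"] by (simp add: eq_neg_iff_add_eq_0 add.commute)

lemma q_0: "q 0 = 0"
  using q_scalar[of 0 0] by simp

lemma q_uminus: "q (- x) = q x"
  using q_scalar[of "- 1" x] by (simp add: scalar_uminus)

lemma q_nonneg: "0 \<le> q x"
  using q_add[of x "- x"] by (simp add: q_uminus q_0)

lemma q_sum: "q (sum f I) \<le> (\<Sum>i\<in>I. q (f i))"
proof (induction I rule: infinite_finite_induct)
  case (insert i I)
  then show ?case using q_add[of "f i" "sum f I"] by simp
qed (simp_all add: q_0)

lemma q_adjoint: "q (adjoint x) = q x"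
proof -
  have le: "q y \<le> q (adjoint y)" for y
  proof (cases "q y = 0")
    case False
    then have "0 < q y" using q_nonneg[of y] by simp
    moreover have "q y * q y \<le> q (adjoint y) * q y"
      using q_mult[of "adjoint y" y] by (simp add: q_star power2_eq_square)
    ultimately show ?thesis by simp
  qed (simp add: q_nonneg)
  show ?thesis using le[of x] le[of "adjoint x"] by simp
qed

lemma q_projection: "projection e \<Longrightarrow> q e \<le> 1"
  using q_star[of e] by (intro square_le_self) (simp add: projection_def)

lemma q_mult_le_1: "q x \<le> 1 \<Longrightarrow> q y \<le> 1 \<Longrightarrow> q (x * y) \<le> 1"
  using q_mult[of x y] mult_mono[of "q x" 1 "q y" 1] q_nonneg by simp

lemma corner_quadratic:
  assumes "e * e = e" "e * k = k" "k * e = k"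
  shows "(e + scalar c * k) * (e + scalar d * k) = e + scalar (c + d) * k + scalar (c * d) * (k * k)"
proof -
  have 1: "scalar c * k * e = scalar c * k" using assms by (simp add: mult.assoc)
  have 2: "e * (scalar d * k) = scalar d * k"
    by (metis assms(2) mult.assoc scalar_commute)
  have 3: "scalar c * k * (scalar d * k) = scalar (c * d) * (k * k)"
    by (metis mult.assoc scalar_commute scalar_mult)
  show ?thesis
    by (simp only: distrib_left distrib_right 1 2 3 assms(1) scalar_add add.assoc)
qed

lemma scalar_combination: "scalar a * (e + scalar b * k + scalar c * l) = scalar a * e + scalar (a * b) * k + scalar (a * c) * l"
  by (simp add: distrib_left scalar_mult mult.assoc)

text \<open>The heart of the extreme point argument. For a real number \<open>k\<close> the hypothesis
  \<open>\<bar>1 + k\<bar> \<le> 1\<close>, \<open>\<bar>1 - k\<bar> \<le> 1\<close> forces \<open>k = 0\<close>, but a norm only sees this through products, adjoints and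
  convex combinations. These are enough to enlarge \<open>k\<close> by a fixed factor: with \<open>u = e + z k\<close>, the product
  \<open>u\<^sup>* u\<close> is a convex combination of \<open>(e + k)\<^sup>2\<close>, \<open>(e - k)\<^sup>2\<close> and \<open>e\<close>, so \<open>u\<close> is a contraction by the
  C*-identity, and \<open>e + (4/3) k\<close> is the mean of \<open>u\<^sup>2\<close> and \<open>(u\<^sup>*)\<^sup>2\<close>.\<close>

lemma corner_scale_up:
  assumes e: "projection e" and k: "e * k = k" "k * e = k" "adjoint k = k"
    and le: "q (e + k) \<le> 1" "q (e - k) \<le> 1"
  shows "q (e + scalar (4/3) * k) \<le> 1"
proof -
  have ee: "e * e = e" and e_adj: "adjoint e = e" using e by (auto simp: projection_def)
  note quad = corner_quadratic[OF ee k(1,2)]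
  \<comment> \<open>The argument of \<open>z\<close> is \<open>\<pi>/4\<close>, so that \<open>z\<^sup>2 + cnj z\<^sup>2 = 0\<close> and the mean of \<open>u\<^sup>2\<close> and \<open>(u\<^sup>*)\<^sup>2\<close> has no
    term in \<open>k\<^sup>2\<close>. The growth factor is \<open>2 Re z\<close>; it exceeds \<open>1\<close> while \<open>z\<close> is still in the unit disc.\<close>
  define z :: complex where "z = Complex (2/3) (2/3)"
  define u where "u = e + scalar z * k"
  have z: "cnj z + z = 4/3" "cnj z * z = 8/9" "z + z + (cnj z + cnj z) = 8/3" "z * z + cnj z * cnj z = 0"
    by (simp_all add: z_def complex_eq_iff)
  have u_adj: "adjoint u = e + scalar (cnj z) * k"
    by (simp add: u_def e_adj k(3) scalar_commute)
  have "adjoint u * u = e + scalar (4/3) * k + scalar (8/9) * (k * k)"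
    unfolding u_adj unfolding u_def quad z ..
  also have "\<dots> = scalar (7/9) * ((e + k) * (e + k)) + scalar (1/9) * ((e - k) * (e - k)) + scalar (1/9) * e"
  proof -
    have p: "(e + k) * (e + k) = e + scalar 2 * k + scalar 1 * (k * k)"
      using quad[of 1 1] by simp
    have m: "(e - k) * (e - k) = e + scalar (- 2) * k + scalar 1 * (k * k)"
      using quad[of "- 1" "- 1"] by (simp add: scalar_uminus)
    have "scalar (7/9) * e + scalar (1/9) * e + scalar (1/9) * e = (scalar (7/9 + 1/9 + 1/9)) * e"
      by (simp only: scalar_add distrib_right)
    then have c0: "scalar (7/9) * e + scalar (1/9) * e + scalar (1/9) * e = e" by simp
    have "scalar (7/9*2) * k + scalar (1/9 * (-2)) * k = scalar (7/9*2 + 1/9 * (-2)) * k"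
      by (simp only: scalar_add distrib_right)
    then have c1: "scalar (7/9*2) * k + scalar (1/9 * (-2)) * k = scalar (4/3) * k" by simp
    have "scalar (7/9*1) * (k*k) + scalar (1/9*1) * (k*k) = scalar (7/9*1 + 1/9*1) * (k*k)"
      by (simp only: scalar_add distrib_right)
    then have c2: "scalar (7/9*1) * (k*k) + scalar (1/9*1) * (k*k) = scalar (8/9) * (k*k)" by simp
    have "scalar (7/9) * ((e + k) * (e + k)) + scalar (1/9) * ((e - k) * (e - k)) + scalar (1/9) * e
        = (scalar (7/9) * e + scalar (1/9) * e + scalar (1/9) * e)
          + (scalar (7/9*2) * k + scalar (1/9 * (-2)) * k)
          + (scalar (7/9*1) * (k*k) + scalar (1/9*1) * (k*k))"
      unfolding p m scalar_combination by (simp only: ac_simps)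
    then show ?thesis unfolding c0 c1 c2 by (rule sym)
  qed
  finally have "(q u)\<^sup>2 = q (scalar (7/9) * ((e + k) * (e + k)) + scalar (1/9) * ((e - k) * (e - k)) + scalar (1/9) * e)"
    by (simp flip: q_star)
  also have "\<dots> \<le> q (scalar (7/9) * ((e + k) * (e + k))) + q (scalar (1/9) * ((e - k) * (e - k))) + q (scalar (1/9) * e)"
    by (intro order_trans[OF q_add] add_mono q_add order_refl)
  also have "\<dots> \<le> 1"
    using q_mult_le_1[OF le(1) le(1)] q_mult_le_1[OF le(2) le(2)] q_projection[OF e]
    by (simp add: q_scalar norm_divide)
  finally have u: "q u \<le> 1"
    using q_nonneg[of u] by (simp add: power_le_one_iff)
  have "e + scalar (4/3) * k = scalar (1/2) * (u * u) + scalar (1/2) * (adjoint u * adjoint u)"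
  proof -
    have "scalar (1/2) * (u * u) + scalar (1/2) * (adjoint u * adjoint u)
      = scalar (1/2) * (e + scalar (z + z) * k + scalar (z * z) * (k * k)
         + (e + scalar (cnj z + cnj z) * k + scalar (cnj z * cnj z) * (k * k)))"
      unfolding u_adj unfolding u_def unfolding quad by (simp only: distrib_left)
    also have "\<dots> = scalar (1/2) * ((scalar 1 * e + scalar 1 * e) + (scalar (z + z) * k + scalar (cnj z + cnj z) * k)
        + (scalar (z * z) * (k * k) + scalar (cnj z * cnj z) * (k * k)))"
      by (simp add: ac_simps)
    also have "\<dots> = scalar (1/2) * (scalar (1 + 1) * e + scalar (8/3) * k + scalar 0 * (k * k))"
      by (simp only: distrib_right[symmetric] scalar_add[symmetric] z)
    also have "\<dots> = scalar (1/2 * (1 + 1)) * e + scalar (1/2 * (8/3)) * k"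
      by (simp only: distrib_left mult.assoc[symmetric] scalar_mult[symmetric]) simp
    finally show ?thesis by simp
  qed
  then have "q (e + scalar (4/3) * k) \<le> q (scalar (1/2) * (u * u)) + q (scalar (1/2) * (adjoint u * adjoint u))"
    using q_add by metis
  also have "\<dots> \<le> 1"
    using q_mult_le_1[OF u u] q_mult_le_1[of "adjoint u" "adjoint u"] u
    by (simp add: q_scalar q_adjoint norm_divide)
  finally show ?thesis .
qed

lemma scaled_corner:
  assumes "e * k = k" "k * e = k" "adjoint k = k" "cnj c = c"
  shows "e * (scalar c * k) = scalar c * k" "scalar c * k * e = scalar c * k"
    "adjoint (scalar c * k) = scalar c * k"
proof -
  have "e * (scalar c * k) = scalar c * (e * k)"
    using scalar_commute[of e c] by (simp flip: mult.assoc)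
  then show "e * (scalar c * k) = scalar c * k" by (simp add: assms)
  show "scalar c * k * e = scalar c * k" by (simp add: assms mult.assoc)
  show "adjoint (scalar c * k) = scalar c * k" by (simp add: assms scalar_commute)
qed

text \<open>Iterating \<open>corner_scale_up\<close> keeps \<open>e + (4/3)\<^sup>n k\<close> in the unit ball for every \<open>n\<close>.\<close>

lemma corner_extreme_point:
  assumes e: "projection e" and k: "e * k = k" "k * e = k" "adjoint k = k"
    and le: "q (e + k) \<le> 1" "q (e - k) \<le> 1"
  shows "q k = 0"
proof -
  have iter: "q (e + scalar ((4/3) ^ n) * k) \<le> 1 \<and> q (e - scalar ((4/3) ^ n) * k) \<le> 1" for n
  proof (induction n)
    case 0
    then show ?case using le by simp
  next
    case (Suc n)
    let ?k = "scalar ((4/3) ^ n) * k"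
    have eq: "e * ?k = ?k" "?k * e = ?k" "adjoint ?k = ?k"
      using k scaled_corner[of e k "(4/3) ^ n"] by simp_all
    have "scalar ((4/3) ^ Suc n) * k = scalar (4/3) * ?k"
      by (simp only: power_Suc scalar_mult mult.assoc)
    then show ?case
      using corner_scale_up[OF e eq] corner_scale_up[OF e, of "- ?k"] Suc eq
      by (simp del: power_Suc)
  qed
  have bound: "(4/3) ^ n * q k \<le> 2" for n
  proof -
    have "(4/3) ^ n * q k = q (scalar ((4/3) ^ n) * k)"
      by (simp add: q_scalar norm_power norm_divide)
    also have "\<dots> = q ((e + scalar ((4/3) ^ n) * k) + - e)" by simp
    also have "\<dots> \<le> q (e + scalar ((4/3) ^ n) * k) + q e"
      using q_add[of "e + scalar ((4/3) ^ n) * k" "- e"] by (simp only: q_uminus)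
    also have "\<dots> \<le> 2" using iter[of n] q_projection[OF e] by simp
    finally show ?thesis .
  qed
  show ?thesis
  proof (rule ccontr)
    assume "q k \<noteq> 0"
    then have pos: "0 < q k" using q_nonneg[of k] by simp
    obtain n where "2 / q k < (4/3 :: real) ^ n"
      using real_arch_pow[of "4/3" "2 / q k"] by auto
    then show False
      using bound[of n] pos by (simp add: field_simps)
  qed
qed

text \<open>Compressing \<open>\<Sum>e\<^sub>l = 1\<close> by \<open>e\<^sub>i\<close> gives \<open>\<Sum> h\<^sub>l = 0\<close> over \<open>l \<noteq> i\<close>, where \<open>h\<^sub>l = e\<^sub>i e\<^sub>l e\<^sub>i\<close>. Positivity of
  the \<open>h\<^sub>l\<close> enters through the estimate \<open>\<parallel>e\<^sub>i - h\<^sub>l\<parallel> \<le> 1\<close>, which holds because \<open>e\<^sub>i - h\<^sub>l\<close> is the compression of \<open>1 - e\<^sub>l\<close>. It bounds both \<open>n e\<^sub>i + h\<^sub>j\<close> and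
  \<open>n e\<^sub>i - h\<^sub>j\<close> by \<open>n\<close>, so \<open>h\<^sub>j / n\<close> vanishes by \<open>corner_extreme_point\<close>, and
  \<open>h\<^sub>j = (e\<^sub>j e\<^sub>i)\<^sup>* (e\<^sub>j e\<^sub>i)\<close>.\<close>

lemma sum_projections_orthogonal:
  fixes e :: "'i \<Rightarrow> 'a"
  assumes fin: "finite I" and e: "\<And>i. i \<in> I \<Longrightarrow> projection (e i)" and sum: "sum e I = 1"
    and i: "i \<in> I" and j: "j \<in> I" and ij: "i \<noteq> j"
  shows "q (e j * e i) = 0"
proof -
  define h where "h = (\<lambda>l. e i * e l * e i)"
  have ei: "e i * e i = e i" "adjoint (e i) = e i" using e[OF i] by (auto simp: projection_def)
  have ej: "e j * e j = e j" "adjoint (e j) = e j" using e[OF j] by (auto simp: projection_def)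
  define J where "J = I - {i, j}"
  define n where "n = card J + 1"
  have "(\<Sum>l\<in>I. h l) = e i * sum e I * e i"
    by (simp add: h_def sum_distrib_left sum_distrib_right)
  also have "\<dots> = e i" by (simp add: sum ei)
  finally have total: "(\<Sum>l\<in>I. h l) = e i" .
  have "I = insert i (insert j J)" "finite J" "i \<notin> insert j J" "j \<notin> J"
    using i j ij fin by (auto simp: J_def)
  then have "(\<Sum>l\<in>I. h l) = h i + (h j + (\<Sum>l\<in>J. h l))"
    by simp
  moreover have "h i = e i" by (simp add: h_def ei)
  ultimately have "h j + (\<Sum>l\<in>J. h l) = 0"
    using total by simp
  then have hj: "h j = - (\<Sum>l\<in>J. h l)"
    by (simp add: eq_neg_iff_add_eq_0)
  have contr: "q (e i - h l) \<le> 1" if "l \<in> I" for l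
  proof -
    have "projection (1 - e l)"
      using e[OF that] by (simp add: projection_def algebra_simps)
    moreover have "e i - h l = e i * (1 - e l) * e i"
      by (simp add: h_def algebra_simps ei)
    ultimately show ?thesis
      by (simp only:) (intro q_mult_le_1 q_projection e[OF i])
  qed
  have scalar_sum: "(\<Sum>l\<in>J. x) = scalar (of_nat (card J)) * x" for x
    by (induction J rule: infinite_finite_induct) (simp_all add: scalar_add distrib_right)
  have n: "scalar (of_nat n) * e i = e i + scalar (of_nat (card J)) * e i"
    by (simp add: n_def scalar_add distrib_right)
  have "scalar (of_nat n) * e i + h j = e i + (\<Sum>l\<in>J. e i - h l)"
    by (simp add: n hj sum_subtractf scalar_sum)
  also have "q \<dots> \<le> q (e i) + (\<Sum>l\<in>J. q (e i - h l))"
    by (intro order_trans[OF q_add] add_mono q_sum order_refl)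
  also have "\<dots> \<le> 1 + (\<Sum>l\<in>J. 1)"
    by (intro add_mono sum_mono contr q_projection e i) (simp add: J_def)
  finally have plus: "q (scalar (of_nat n) * e i + h j) \<le> real n"
    by (simp add: n_def)
  have "scalar (of_nat n) * e i - h j = scalar (of_nat (card J)) * e i + (e i - h j)"
    by (simp add: n)
  also have "q \<dots> \<le> q (scalar (of_nat (card J)) * e i) + q (e i - h j)"
    by (rule q_add)
  also have "\<dots> \<le> real (card J) * 1 + 1"
    unfolding q_scalar norm_of_nat by (intro add_mono mult_left_mono contr q_projection e i j) simp
  finally have minus: "q (scalar (of_nat n) * e i - h j) \<le> real n"
    by (simp add: n_def)
  have "n > 0" by (simp add: n_def)
  let ?k = "scalar (1 / of_nat n) * h j"
  have inv: "scalar (1 / of_nat n) * (scalar (of_nat n) * x) = x" for x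
  proof -
    have "scalar (1 / of_nat n) * (scalar (of_nat n) * x) = scalar (1 / of_nat n * of_nat n) * x"
      by (simp only: scalar_mult mult.assoc)
    then show ?thesis using \<open>n > 0\<close> by simp
  qed
  have "q ?k = 0"
  proof (rule corner_extreme_point[OF e[OF i]])
    have "e i * h j = e i * e i * e j * e i" "h j * e i = e i * e j * (e i * e i)"
      by (simp_all only: h_def mult.assoc)
    then have "e i * h j = h j" "h j * e i = h j" "adjoint (h j) = h j"
      by (simp_all add: ei h_def) (simp add: ei ej mult.assoc)
    from scaled_corner[OF this, of "1 / of_nat n"]
    show "e i * ?k = ?k" "?k * e i = ?k" "adjoint ?k = ?k" by simp_all
    have "e i + ?k = scalar (1 / of_nat n) * (scalar (of_nat n) * e i + h j)"
      by (simp add: distrib_left inv)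
    then show "q (e i + ?k) \<le> 1"
      using plus \<open>n > 0\<close> by (simp add: q_scalar norm_divide)
    have "e i - ?k = scalar (1 / of_nat n) * (scalar (of_nat n) * e i - h j)"
      by (simp add: right_diff_distrib inv)
    then show "q (e i - ?k) \<le> 1"
      using minus \<open>n > 0\<close> by (simp add: q_scalar norm_divide)
  qed
  then have "q (h j) = 0"
    using \<open>n > 0\<close> by (simp add: q_scalar)
  moreover have "adjoint (e j * e i) * (e j * e i) = h j"
  proof -
    have "adjoint (e j * e i) * (e j * e i) = e i * (e j * e j) * e i"
      by (simp only: adjoint_mult ei(2) ej(2) mult.assoc)
    then show ?thesis by (simp only: ej h_def)
  qed
  ultimately show ?thesis
    using q_star[of "e j * e i"] by simp
qed

end

section \<open>Integer powers of a unitary\<close>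

definition unitary :: "'a::star_ring \<Rightarrow> bool" where
  "unitary u \<longleftrightarrow> adjoint u * u = 1 \<and> u * adjoint u = 1"

definition upower :: "'a::star_ring \<Rightarrow> int \<Rightarrow> 'a" where
  "upower u k = (if 0 \<le> k then u ^ nat k else adjoint u ^ nat (- k))"

lemma isometry_right_inverse_unitary:
  assumes "adjoint u * u = 1" "u * w = 1"
  shows "unitary u" "adjoint u = w"
proof -
  have "adjoint u = adjoint u * (u * w)" using assms(2) by simp
  also have "\<dots> = w" using assms(1) by (simp flip: mult.assoc)
  finally show "adjoint u = w" .
  then show "unitary u" using assms by (simp add: unitary_def)
qed

lemma upower_0 [simp]: "upower u 0 = 1" and upower_1 [simp]: "upower u 1 = u"
  by (simp_all add: upower_def)

lemma upower_of_nat: "upower u (int n) = u ^ n"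
  by (simp add: upower_def)

lemma upower_of_neg: "upower u (- int n) = adjoint u ^ n"
  by (cases "n = 0") (simp_all add: upower_def)

lemma adjoint_upower: "adjoint (upower u k) = upower u (- k)"
  by (cases "k = 0") (simp_all add: upower_def adjoint_power)

lemma upower_adjoint: "upower (adjoint u) k = upower u (- k)"
  by (cases "k = 0") (simp_all add: upower_def)

context
  fixes u :: "'a::star_ring"
  assumes u: "unitary u"
begin

lemma upower_plus_1: "upower u (k + 1) = upower u k * u"
proof (cases "0 \<le> k")
  case True
  then have "nat (k + 1) = Suc (nat k)" by simp
  then show ?thesis using True by (simp add: upower_def power_Suc2 del: power_Suc)
next
  case False
  define n where "n = nat (- k) - 1"
  have k: "k = - int (Suc n)" "k + 1 = - int n" using False by (simp_all add: n_def)
  have "upower u k * u = adjoint u ^ n * (adjoint u * u)"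
    unfolding k(1) upower_of_neg by (simp add: power_Suc2 mult.assoc del: power_Suc)
  then show ?thesis
    using u unfolding k(2) upower_of_neg by (simp add: unitary_def)
qed

lemma upower_minus_1: "upower u (k - 1) = upower u k * adjoint u"
  using upower_plus_1[of "k - 1"] u by (simp add: mult.assoc unitary_def)

lemma upower_add: "upower u (k + l) = upower u k * upower u l"
proof (induction l rule: int_induct[of _ 0])
  case (step1 i)
  then show ?case
    using upower_plus_1[of "k + i"] upower_plus_1[of i] by (simp add: add.assoc mult.assoc)
next
  case (step2 i)
  then show ?case
    using upower_minus_1[of "k + i"] upower_minus_1[of i] by (simp add: add_diff_eq mult.assoc)
qed simp

lemma unitary_upower: "unitary (upower u k)"
  unfolding unitary_def adjoint_upower by (simp flip: upower_add)

end

section \<open>Principal right ideals of the monoid\<close>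

lemma ZZ_simps [simp]: "(m, a) \<in> carrier ZZ \<longleftrightarrow> a \<noteq> 0" "(m, a) \<otimes>\<^bsub>ZZ\<^esub> (n, b) = (m + a * n, a * b)"
  by (simp_all add: ZZ_def)

lemma ZZ_mult_closed: "p \<in> carrier ZZ \<Longrightarrow> q \<in> carrier ZZ \<Longrightarrow> p \<otimes>\<^bsub>ZZ\<^esub> q \<in> carrier ZZ"
  by (cases p; cases q) simp

lemma right_ideal_ZZ:
  assumes "a \<noteq> 0"
  shows "right_ideal ZZ (m, a) = {(x, y). y \<noteq> 0 \<and> a dvd x - m \<and> a dvd y}" (is "?L = ?R")
proof
  show "?L \<subseteq> ?R"
    using assms by (auto simp: right_ideal_def translate_def)
  show "?R \<subseteq> ?L"
  proof clarify
    fix x y assume "y \<noteq> 0" "a dvd x - m" "a dvd y"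
    then obtain n b where "x = m + a * n" "y = a * b" "b \<noteq> 0"
      by (metis add.commute diff_add_cancel dvd_def mult_zero_right)
    then show "(x, y) \<in> ?L"
      unfolding right_ideal_def translate_def by (intro image_eqI[of _ _ "(n, b)"]) simp_all
  qed
qed

lemma right_ideal_self: "p \<in> carrier ZZ \<Longrightarrow> p \<in> right_ideal ZZ p"
  by (cases p) (simp add: right_ideal_ZZ)

lemma translate_right_ideal:
  assumes "p \<in> carrier ZZ" "q \<in> carrier ZZ"
  shows "translate ZZ p (right_ideal ZZ q) = right_ideal ZZ (p \<otimes>\<^bsub>ZZ\<^esub> q)"
proof -
  have "p \<otimes>\<^bsub>ZZ\<^esub> (q \<otimes>\<^bsub>ZZ\<^esub> x) = p \<otimes>\<^bsub>ZZ\<^esub> q \<otimes>\<^bsub>ZZ\<^esub> x" for x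
    by (cases p; cases q; cases x) (simp add: algebra_simps)
  then show ?thesis by (simp add: right_ideal_def translate_def image_image)
qed

lemma right_ideal_one: "right_ideal ZZ (0, 1) = carrier ZZ"
  by (auto simp: right_ideal_ZZ)

lemma constructible_cases [consumes 1, case_names empty ideal]:
  assumes "X \<in> constructible_ideals ZZ"
  obtains "X = {}" | m a where "a \<noteq> 0" "X = right_ideal ZZ (m, a)"
  using assms by (auto simp: constructible_ideals_def)

text \<open>The right LCM property: residue classes that meet do so in a residue class
  modulo the least common multiple.\<close>

lemma right_ideal_inter:
  assumes "a \<noteq> 0" "b \<noteq> 0" "(z, c) \<in> right_ideal ZZ (m, a) \<inter> right_ideal ZZ (n, b)"
  shows "right_ideal ZZ (m, a) \<inter> right_ideal ZZ (n, b) = right_ideal ZZ (z, lcm a b)"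
proof -
  have z: "a dvd z - m" "b dvd z - n" using assms by (simp_all add: right_ideal_ZZ)
  have "a dvd x - m \<longleftrightarrow> a dvd x - z" "b dvd x - n \<longleftrightarrow> b dvd x - z" for x
    using dvd_add_left_iff[OF z(1), of "x - z"] dvd_add_left_iff[OF z(2), of "x - z"] by simp_all
  then show ?thesis
    using assms(1,2) by (auto simp: right_ideal_ZZ lcm_eq_0_iff)
qed

lemma foundation_residues:
  assumes "0 < N"
  shows "foundation_set ZZ ((\<lambda>j. (int j, int N)) ` {..<N})"
  unfolding foundation_set_def
proof (intro conjI ballI)
  fix p assume "p \<in> carrier ZZ"
  then obtain m b where p: "p = (m, b)" "b \<noteq> 0" by (cases p) auto
  let ?q = "(m mod int N, int N)"
  have "?q \<in> (\<lambda>j. (int j, int N)) ` {..<N}"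
    using assms by (intro image_eqI[of _ _ "nat (m mod int N)"]) (auto simp: nat_less_iff)
  moreover have "(m, b * int N) \<in> right_ideal ZZ p \<inter> right_ideal ZZ ?q"
    using assms p by (simp add: right_ideal_ZZ minus_mod_eq_mult_div)
  ultimately show "\<exists>q\<in>(\<lambda>j. (int j, int N)) ` {..<N}. right_ideal ZZ p \<inter> right_ideal ZZ q \<noteq> {}"
    by blast
qed (use assms in auto)

lemma residues_disjoint:
  assumes "i < N" "j < N" "i \<noteq> j"
  shows "right_ideal ZZ (int i, int N) \<inter> right_ideal ZZ (int j, int N) = {}"
proof -
  have False if "int N dvd x - int i" "int N dvd x - int j" for x
  proof -
    have "int N dvd (x - int i) - (x - int j)" using that by (rule dvd_diff)
    then have "int j mod int N = int i mod int N" by (simp add: mod_eq_dvd_iff)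
    then show False using assms by simp
  qed
  then show ?thesis using assms by (auto simp: right_ideal_ZZ)
qed

section \<open>From the boundary quotient relations to the relations of \<open>Q\<^sub>\<int>\<close>\<close>

locale qz_relations =
  fixes s :: "'a::star_ring" and v :: "int \<Rightarrow> 'a"
  assumes s_unitary: "unitary s"
    and v_isometry: "a \<noteq> 0 \<Longrightarrow> adjoint (v a) * v a = 1"
    and v_mult: "a \<noteq> 0 \<Longrightarrow> b \<noteq> 0 \<Longrightarrow> v a * v b = v (a * b)"
    and v_s: "a \<noteq> 0 \<Longrightarrow> v a * s = upower s a * v a"
    and v_adjoint_s: "a \<noteq> 0 \<Longrightarrow> v a * adjoint s = upower (adjoint s) a * v a"
    and v_sum: "a \<noteq> 0 \<Longrightarrow> (\<Sum>j<nat \<bar>a\<bar>. s ^ j * v a * adjoint (v a) * adjoint s ^ j) = 1"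

locale bq_relations =
  fixes w :: "int \<times> int \<Rightarrow> 'a::star_ring" and e :: "(int \<times> int) set \<Rightarrow> 'a"
  assumes w_isometry: "p \<in> carrier ZZ \<Longrightarrow> adjoint (w p) * w p = 1"
    and e_projection: "X \<in> constructible_ideals ZZ \<Longrightarrow> projection (e X)"
    and w_mult: "p \<in> carrier ZZ \<Longrightarrow> q \<in> carrier ZZ \<Longrightarrow> w p * w q = w (p \<otimes>\<^bsub>ZZ\<^esub> q)"
    and w_e: "p \<in> carrier ZZ \<Longrightarrow> X \<in> constructible_ideals ZZ \<Longrightarrow> w p * e X * adjoint (w p) = e (translate ZZ p X)"
    and e_carrier: "e (carrier ZZ) = 1"
    and e_empty: "e {} = 0"
    and e_mult: "X \<in> constructible_ideals ZZ \<Longrightarrow> Y \<in> constructible_ideals ZZ \<Longrightarrow> e X * e Y = e (X \<inter> Y)"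
    and e_foundation: "distinct ps \<Longrightarrow> foundation_set ZZ (set ps) \<Longrightarrow>
      prod_list (map (\<lambda>p. 1 - e (right_ideal ZZ p)) ps) = 0"
begin

text \<open>An idempotent isometry is the identity.\<close>

lemma w_one: "w (0, 1) = 1"
proof -
  have "w (0, 1) = adjoint (w (0, 1)) * w (0, 1) * w (0, 1)" by (simp add: w_isometry)
  also have "\<dots> = adjoint (w (0, 1)) * w (0, 1)" by (simp add: w_mult mult.assoc)
  finally show ?thesis by (simp add: w_isometry)
qed

lemma w_unitary: "unitary (w (k, 1))" and w_adjoint: "adjoint (w (k, 1)) = w (- k, 1)"
  using isometry_right_inverse_unitary[of "w (k, 1)" "w (- k, 1)"]
  by (simp_all add: w_isometry w_mult w_one)

lemma upower_w: "upower (w (1, 1)) k = w (k, 1)"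
proof (induction k rule: int_induct[of _ 0])
  case base
  show ?case by (simp add: w_one)
next
  case (step1 i)
  then show ?case by (simp add: upower_plus_1[OF w_unitary] w_mult)
next
  case (step2 i)
  then show ?case by (simp add: upower_minus_1[OF w_unitary] w_adjoint w_mult)
qed

lemma w_factor: "a \<noteq> 0 \<Longrightarrow> upower (w (1, 1)) m * w (0, a) = w (m, a)"
  by (simp add: upower_w w_mult)

lemma range_projection: "p \<in> carrier ZZ \<Longrightarrow> w p * adjoint (w p) = e (right_ideal ZZ p)"
proof -
  assume p: "p \<in> carrier ZZ"
  have "right_ideal ZZ (0, 1) \<in> constructible_ideals ZZ"
    unfolding constructible_ideals_def by (intro UnI1 imageI) simp
  then have "w p * e (carrier ZZ) * adjoint (w p) = e (translate ZZ p (carrier ZZ))"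
    using p by (intro w_e) (simp_all add: right_ideal_one)
  then show ?thesis by (simp add: e_carrier right_ideal_def)
qed

text \<open>Expanding the product, every term with two factors or more vanishes.\<close>

lemma prod_orthogonal:
  fixes f :: "'i \<Rightarrow> 'a"
  assumes "distinct xs" "\<And>i j. i \<in> set xs \<Longrightarrow> j \<in> set xs \<Longrightarrow> i \<noteq> j \<Longrightarrow> f i * f j = 0"
  shows "prod_list (map (\<lambda>i. 1 - f i) xs) = 1 - sum f (set xs)"
  using assms
proof (induction xs)
  case (Cons i xs)
  have IH: "prod_list (map (\<lambda>i. 1 - f i) xs) = 1 - sum f (set xs)"
    using Cons.prems by (intro Cons.IH) auto
  have "f i * sum f (set xs) = (\<Sum>j\<in>set xs. 0)"
    unfolding sum_distrib_left using Cons.prems by (intro sum.cong) auto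
  then have "(1 - f i) * (1 - sum f (set xs)) = 1 - (f i + sum f (set xs))"
    by (simp add: left_diff_distrib right_diff_distrib)
  then show ?case
    using Cons.prems IH by simp
qed simp

lemma residues_sum:
  assumes "0 < N"
  shows "(\<Sum>j<N. e (right_ideal ZZ (int j, int N))) = 1"
proof -
  define ps where "ps = map (\<lambda>j. (int j, int N)) [0..<N]"
  have J: "right_ideal ZZ (int j, int N) \<in> constructible_ideals ZZ" for j
    using assms by (auto simp: constructible_ideals_def)
  have "distinct ps" by (auto simp: ps_def distinct_map inj_on_def)
  moreover have "set ps = (\<lambda>j. (int j, int N)) ` {..<N}" by (auto simp: ps_def)
  ultimately have "prod_list (map (\<lambda>p. 1 - e (right_ideal ZZ p)) ps) = 0"
    using foundation_residues[OF assms] by (intro e_foundation) simp_all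
  moreover have "prod_list (map (\<lambda>p. 1 - e (right_ideal ZZ p)) ps)
      = prod_list (map (\<lambda>j. 1 - e (right_ideal ZZ (int j, int N))) [0..<N])"
    by (simp add: ps_def comp_def)
  moreover have "\<dots> = 1 - (\<Sum>j<N. e (right_ideal ZZ (int j, int N)))"
    using prod_orthogonal[of "[0..<N]" "\<lambda>j. e (right_ideal ZZ (int j, int N))"]
    by (simp add: e_mult J residues_disjoint e_empty atLeast0LessThan)
  ultimately show ?thesis by simp
qed

theorem qz_relations_w: "qz_relations (w (1, 1)) (\<lambda>a. w (0, a))"
proof
  fix a :: int assume a: "a \<noteq> 0"
  show "w (0, a) * w (1, 1) = upower (w (1, 1)) a * w (0, a)"
    using a by (simp add: upower_w w_mult)
  show "w (0, a) * adjoint (w (1, 1)) = upower (adjoint (w (1, 1))) a * w (0, a)"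
    unfolding upower_adjoint unfolding upower_w w_adjoint using a by (simp add: w_mult)
  have "w (1, 1) ^ j * w (0, a) * adjoint (w (0, a)) * adjoint (w (1, 1)) ^ j
      = e (right_ideal ZZ (int j, int (nat \<bar>a\<bar>)))" for j
  proof -
    have "w (1, 1) ^ j * w (0, a) * adjoint (w (0, a)) * adjoint (w (1, 1)) ^ j
        = (w (1, 1) ^ j * w (0, a)) * adjoint (w (1, 1) ^ j * w (0, a))"
      by (simp add: adjoint_power mult.assoc)
    also have "\<dots> = w (int j, a) * adjoint (w (int j, a))"
      using w_factor[OF a, of "int j"] by (simp only: upower_of_nat)
    also have "\<dots> = e (right_ideal ZZ (int j, a))"
      using a by (simp add: range_projection)
    finally show ?thesis
      using a by (simp add: right_ideal_ZZ)
  qed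
  then show "(\<Sum>j<nat \<bar>a\<bar>. w (1, 1) ^ j * w (0, a) * adjoint (w (0, a)) * adjoint (w (1, 1)) ^ j) = 1"
    using residues_sum[of "nat \<bar>a\<bar>"] a by simp
qed (simp_all add: w_unitary w_isometry w_mult)

end

section \<open>From the relations of \<open>Q\<^sub>\<int>\<close> to the boundary quotient relations\<close>

text \<open>In a bare star-ring, projections with sum \<open>1\<close> need not be orthogonal; in the algebra of a
  presentation they are, by \<open>sum_projections_orthogonal\<close>.\<close>

locale qz_relations_orthogonal = qz_relations s v for s :: "'a::star_ring" and v +
  assumes orthogonal: "\<And>(f :: nat \<Rightarrow> 'a) I i j. finite I \<Longrightarrow> (\<And>i. i \<in> I \<Longrightarrow> projection (f i)) \<Longrightarrow>
      sum f I = 1 \<Longrightarrow> i \<in> I \<Longrightarrow> j \<in> I \<Longrightarrow> i \<noteq> j \<Longrightarrow> f i * f j = 0"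
begin

abbreviation "sp \<equiv> upower s"

definition w :: "int \<times> int \<Rightarrow> 'a" where
  "w p = sp (fst p) * v (snd p)"

definition range_proj :: "int \<times> int \<Rightarrow> 'a" where
  "range_proj p = w p * adjoint (w p)"

lemma v_sp: "a \<noteq> 0 \<Longrightarrow> v a * sp n = sp (a * n) * v a"
proof (induction n rule: int_induct[of _ 0])
  case (step1 i)
  have "v a * sp (i + 1) = sp (a * i) * (v a * s)"
    using step1 by (simp add: upower_plus_1[OF s_unitary] flip: mult.assoc)
  also have "\<dots> = sp (a * (i + 1)) * v a"
    using step1 by (simp add: v_s upower_add[OF s_unitary] distrib_left mult.assoc)
  finally show ?case .
next
  case (step2 i)
  have "v a * sp (i - 1) = sp (a * i) * (v a * adjoint s)"
    using step2 by (simp add: upower_minus_1[OF s_unitary] flip: mult.assoc)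
  also have "\<dots> = sp (a * i) * sp (- a) * v a"
    using step2 by (simp add: v_adjoint_s upower_adjoint mult.assoc)
  also have "\<dots> = sp (a * (i - 1)) * v a"
    by (simp add: right_diff_distrib flip: upower_add[OF s_unitary])
  finally show ?case .
qed simp

lemma w_mult: "p \<in> carrier ZZ \<Longrightarrow> q \<in> carrier ZZ \<Longrightarrow> w p * w q = w (p \<otimes>\<^bsub>ZZ\<^esub> q)"
proof -
  assume "p \<in> carrier ZZ" "q \<in> carrier ZZ"
  then obtain m a n b where pq: "p = (m, a)" "a \<noteq> 0" "q = (n, b)" "b \<noteq> 0"
    by (cases p; cases q) auto
  have "w p * w q = sp m * (v a * sp n) * v b"
    by (simp add: w_def pq mult.assoc)
  also have "\<dots> = (sp m * sp (a * n)) * (v a * v b)"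
    using pq by (simp add: v_sp mult.assoc)
  finally show ?thesis
    using pq by (simp add: w_def v_mult upower_add[OF s_unitary])
qed

lemma w_isometry: "p \<in> carrier ZZ \<Longrightarrow> adjoint (w p) * w p = 1"
proof -
  assume "p \<in> carrier ZZ"
  then have "snd p \<noteq> 0" by (cases p) simp
  have "adjoint (w p) * w p = adjoint (v (snd p)) * (adjoint (sp (fst p)) * sp (fst p)) * v (snd p)"
    by (simp add: w_def mult.assoc)
  also have "\<dots> = 1"
    using unitary_upower[OF s_unitary] \<open>snd p \<noteq> 0\<close> by (simp add: unitary_def v_isometry)
  finally show ?thesis .
qed

lemma w_one: "w (0, 1) = 1"
proof -
  have "w (0, 1) = adjoint (w (0, 1)) * w (0, 1) * w (0, 1)" by (simp add: w_isometry)
  also have "\<dots> = adjoint (w (0, 1)) * w (0, 1)" by (simp add: w_mult mult.assoc)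
  finally show ?thesis by (simp add: w_isometry)
qed

lemma range_proj_projection: "p \<in> carrier ZZ \<Longrightarrow> projection (range_proj p)"
proof -
  assume p: "p \<in> carrier ZZ"
  have "range_proj p * range_proj p = w p * (adjoint (w p) * w p) * adjoint (w p)"
    by (simp add: range_proj_def mult.assoc)
  then show ?thesis
    by (simp add: projection_def w_isometry[OF p]) (simp add: range_proj_def)
qed

lemma range_proj_conj:
  "p \<in> carrier ZZ \<Longrightarrow> q \<in> carrier ZZ \<Longrightarrow> w p * range_proj q * adjoint (w p) = range_proj (p \<otimes>\<^bsub>ZZ\<^esub> q)"
  by (simp add: range_proj_def mult.assoc flip: w_mult)

lemma range_proj_unit:
  assumes p: "p \<in> carrier ZZ" and u: "u \<in> carrier ZZ" and "unitary (w u)"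
  shows "range_proj (p \<otimes>\<^bsub>ZZ\<^esub> u) = range_proj p"
  using assms(3) range_proj_conj[OF p u] by (simp add: range_proj_def unitary_def)

text \<open>If \<open>pP = qP\<close> then \<open>q = pu\<close> and \<open>p = qu'\<close>, so \<open>w\<^sub>u\<close> is an isometry with right inverse
  \<open>w\<^bsub>u'\<^esub>\<close>, that is, a unitary, and it cancels in the range projection.\<close>

lemma range_proj_cong:
  assumes p: "p \<in> carrier ZZ" and q: "q \<in> carrier ZZ" and eq: "right_ideal ZZ p = right_ideal ZZ q"
  shows "range_proj p = range_proj q"
proof -
  have "q \<in> right_ideal ZZ p"
    unfolding eq by (rule right_ideal_self[OF q])
  moreover have "p \<in> right_ideal ZZ q"
    unfolding eq[symmetric] by (rule right_ideal_self[OF p])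
  ultimately obtain u u' where u: "u \<in> carrier ZZ" "q = p \<otimes>\<^bsub>ZZ\<^esub> u" and u': "u' \<in> carrier ZZ" "p = q \<otimes>\<^bsub>ZZ\<^esub> u'"
    unfolding right_ideal_def translate_def by blast
  have wp: "w p = w p * (w u * w u')"
    using w_mult[OF q u'(1)] w_mult[OF p u(1)] unfolding u(2)[symmetric] u'(2)[symmetric]
    by (metis mult.assoc)
  have "w u * w u' = adjoint (w p) * w p * (w u * w u')"
    by (simp add: w_isometry[OF p])
  also have "\<dots> = adjoint (w p) * (w p * (w u * w u'))"
    by (simp only: mult.assoc)
  also have "\<dots> = 1" unfolding wp[symmetric] by (rule w_isometry[OF p])
  finally have "unitary (w u)"
    using isometry_right_inverse_unitary(1) w_isometry[OF u(1)] by blast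
  then show ?thesis
    unfolding u(2) by (rule range_proj_unit[OF p u(1), symmetric])
qed

lemma range_proj_sum:
  assumes "c \<noteq> 0"
  shows "(\<Sum>j<nat \<bar>c\<bar>. range_proj (int j, c)) = 1"
proof -
  have "range_proj (int j, c) = s ^ j * v c * adjoint (v c) * adjoint s ^ j" for j
    by (simp add: range_proj_def w_def upower_of_nat adjoint_power mult.assoc)
  then show ?thesis using v_sum[OF assms] by simp
qed

text \<open>The relation \<open>v_sum\<close>, conjugated by \<open>w\<^bsub>(m,a)\<^esub>\<close>: the class of \<open>m\<close> modulo \<open>a\<close> is a disjoint union of
  classes modulo \<open>a c\<close>.\<close>

lemma range_proj_refine:
  assumes "a \<noteq> 0" "c \<noteq> 0"
  shows "range_proj (m, a) = (\<Sum>j<nat \<bar>c\<bar>. range_proj (m + a * int j, a * c))"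
proof -
  have "range_proj (m, a) = w (m, a) * (\<Sum>j<nat \<bar>c\<bar>. range_proj (int j, c)) * adjoint (w (m, a))"
    by (simp add: range_proj_sum[OF assms(2)]) (simp add: range_proj_def)
  also have "\<dots> = (\<Sum>j<nat \<bar>c\<bar>. w (m, a) * range_proj (int j, c) * adjoint (w (m, a)))"
    by (simp only: sum_distrib_left sum_distrib_right)
  finally show ?thesis
    using assms by (simp add: range_proj_conj)
qed

text \<open>By \<open>v_sum\<close> the residue projections modulo \<open>N\<close> sum to \<open>1\<close>, so distinct ones are
  orthogonal; the rest is reduction of \<open>x\<close> and \<open>y\<close> modulo \<open>N\<close>.\<close>

lemma residue_mult:
  assumes N: "0 < N"
  shows "range_proj (x, int N) * range_proj (y, int N) = (if int N dvd x - y then range_proj (y, int N) else 0)"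
proof -
  have reduce: "range_proj (z, int N) = range_proj (int (nat (z mod int N)), int N)" for z
  proof (rule range_proj_cong)
    have "z mod int N = int (nat (z mod int N))" using N by simp
    moreover have "int N dvd t - z \<longleftrightarrow> int N dvd t - z mod int N" for t
      by (simp add: mod_simps flip: mod_eq_dvd_iff)
    ultimately show "right_ideal ZZ (z, int N) = right_ideal ZZ (int (nat (z mod int N)), int N)"
      using N by (simp add: right_ideal_ZZ)
  qed (use N in simp_all)
  let ?i = "nat (x mod int N)" and ?j = "nat (y mod int N)"
  have ij: "?i < N" "?j < N" using N by (simp_all add: nat_less_iff)
  have iff: "int N dvd x - y \<longleftrightarrow> ?i = ?j"
    using N by (simp add: nat_eq_iff flip: mod_eq_dvd_iff)
  have "range_proj (int ?i, int N) * range_proj (int ?j, int N) = 0" if "?i \<noteq> ?j"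
    using N ij that range_proj_sum[of "int N"]
    by (intro orthogonal[where f = "\<lambda>i. range_proj (int i, int N)" and I = "{..<N}"])
      (auto intro: range_proj_projection)
  moreover have "range_proj (int ?j, int N) * range_proj (int ?j, int N) = range_proj (int ?j, int N)"
    using range_proj_projection[of "(int ?j, int N)"] N by (simp add: projection_def)
  ultimately have "range_proj (int ?i, int N) * range_proj (int ?j, int N)
      = (if ?i = ?j then range_proj (int ?j, int N) else 0)"
    by (cases "?i = ?j") (simp_all only: if_True if_False simp_thms)
  then show ?thesis
    unfolding iff by (simp only: flip: reduce[of x] reduce[of y])
qed

text \<open>The range projection of \<open>w\<^bsub>(m,a)\<^esub>\<close> is diagonal with respect to the residue projections modulo any
  multiple of \<open>a\<close>, with the indicator of the residue class of \<open>m\<close> as its diagonal.\<close>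

lemma range_proj_residue:
  assumes N: "0 < N" and a: "a \<noteq> 0" "a dvd int N"
  shows "range_proj (m, a) * range_proj (x, int N) = (if a dvd x - m then range_proj (x, int N) else 0)"
proof -
  obtain c where c: "int N = a * c" using a(2) by blast
  then have "c \<noteq> 0" using N by auto
  define n where "n = nat \<bar>c\<bar>"
  have "n > 0" using \<open>c \<noteq> 0\<close> by (simp add: n_def)
  have "range_proj (m, a) * range_proj (x, int N)
      = (\<Sum>j<n. range_proj (m + a * int j, int N) * range_proj (x, int N))"
    using range_proj_refine[OF a(1) \<open>c \<noteq> 0\<close>] by (simp add: n_def c sum_distrib_right)
  also have "\<dots> = (\<Sum>j<n. if int N dvd m + a * int j - x then range_proj (x, int N) else 0)"
    by (simp add: residue_mult[OF N])
  also have "\<dots> = (if a dvd x - m then range_proj (x, int N) else 0)"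
  proof (cases "a dvd x - m")
    case False
    have "\<not> int N dvd m + a * int j - x" for j
    proof
      assume "int N dvd m + a * int j - x"
      then have "a dvd m + a * int j - x" by (rule dvd_trans[OF a(2)])
      then have "a dvd a * int j - (m + a * int j - x)" by (rule dvd_diff[OF dvd_triv_left])
      then show False using False by (simp add: algebra_simps)
    qed
    then show ?thesis using False by simp
  next
    case True
    then obtain t where t: "x = m + a * t" by (metis add.commute diff_add_cancel dvdE)
    \<comment> \<open>Of the \<open>\<bar>c\<bar>\<close> subclasses in the refinement exactly one is the class of \<open>x = m + a t\<close>.\<close>
    have "int N dvd m + a * int j - x \<longleftrightarrow> j = nat (t mod int n)" if "j < n" for j
    proof -
      have "m + a * int j - x = a * (int j - t)" by (simp add: t right_diff_distrib)
      then have "int N dvd m + a * int j - x \<longleftrightarrow> int n dvd int j - t"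
        using a(1) by (simp add: c n_def)
      also have "\<dots> \<longleftrightarrow> int j = t mod int n"
        using that by (simp flip: mod_eq_dvd_iff)
      also have "\<dots> \<longleftrightarrow> j = nat (t mod int n)"
        using nat_0_le[of "t mod int n"] \<open>n > 0\<close> by auto
      finally show ?thesis .
    qed
    then have "(\<Sum>j<n. if int N dvd m + a * int j - x then range_proj (x, int N) else 0)
        = (\<Sum>j<n. if j = nat (t mod int n) then range_proj (x, int N) else 0)"
      by (intro sum.cong) auto
    also have "\<dots> = range_proj (x, int N)"
      using \<open>n > 0\<close> by (simp add: nat_less_iff)
    finally show ?thesis using True by simp
  qed
  finally show ?thesis .
qed

text \<open>The residue projections sum to \<open>1\<close>, so an element is determined by its products with them.\<close>

lemma residue_eqI:
  assumes N: "0 < N" and eq: "\<And>x. y * range_proj (x, int N) = z * range_proj (x, int N)"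
  shows "y = z"
proof -
  have sum: "t = (\<Sum>j<N. t * range_proj (int j, int N))" for t
    using range_proj_sum[of "int N"] N by (simp flip: sum_distrib_left)
  have "y = (\<Sum>j<N. z * range_proj (int j, int N))"
    using sum[of y] by (simp only: eq)
  then show ?thesis using sum[of z] by simp
qed

text \<open>The choice of a generator of the ideal is immaterial by \<open>range_proj_cong\<close>.\<close>

definition e :: "(int \<times> int) set \<Rightarrow> 'a" where
  "e X = (if X = {} then 0 else range_proj (SOME p. p \<in> carrier ZZ \<and> X = right_ideal ZZ p))"

lemma e_right_ideal: "p \<in> carrier ZZ \<Longrightarrow> e (right_ideal ZZ p) = range_proj p"
proof -
  assume p: "p \<in> carrier ZZ"
  let ?q = "SOME q. q \<in> carrier ZZ \<and> right_ideal ZZ p = right_ideal ZZ q"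
  have "?q \<in> carrier ZZ \<and> right_ideal ZZ p = right_ideal ZZ ?q"
    by (rule someI[of _ p]) (simp add: p)
  then have "range_proj p = range_proj ?q"
    using range_proj_cong[OF p] by blast
  then show ?thesis
    using right_ideal_self[OF p] by (simp add: e_def) blast
qed

lemma e_empty: "e {} = 0"
  by (simp add: e_def)

text \<open>Both sides are diagonal over the residues modulo \<open>a b\<close>, and the diagonals are indicators of
  residue classes.\<close>

lemma e_mult:
  assumes X: "X \<in> constructible_ideals ZZ" and Y: "Y \<in> constructible_ideals ZZ"
  shows "e X * e Y = e (X \<inter> Y)"
proof (cases "X = {} \<or> Y = {}")
  case True
  then show ?thesis by (auto simp: e_empty)
next
  case False
  obtain m a where X: "X = right_ideal ZZ (m, a)" "a \<noteq> 0"
    using constructible_cases[OF assms(1)] False by metis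
  obtain n b where Y: "Y = right_ideal ZZ (n, b)" "b \<noteq> 0"
    using constructible_cases[OF assms(2)] False by metis
  define N where "N = nat \<bar>a * b\<bar>"
  have N: "0 < N" "a dvd int N" "b dvd int N" "lcm a b dvd int N"
    using X Y by (simp_all add: N_def lcm_least)
  have eX: "e X * range_proj (x, int N) = (if a dvd x - m then range_proj (x, int N) else 0)" for x
    using range_proj_residue[OF N(1) X(2) N(2)] X by (simp add: e_right_ideal)
  have eY: "e Y * range_proj (x, int N) = (if b dvd x - n then range_proj (x, int N) else 0)" for x
    using range_proj_residue[OF N(1) Y(2) N(3)] Y by (simp add: e_right_ideal)
  have eXY: "e (X \<inter> Y) * range_proj (x, int N)
      = (if a dvd x - m \<and> b dvd x - n then range_proj (x, int N) else 0)" for x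
  proof (cases "X \<inter> Y = {}")
    case True
    have "(x, a * b) \<notin> X \<inter> Y" using True by simp
    then show ?thesis using X Y True by (auto simp: right_ideal_ZZ e_empty)
  next
    case False
    then obtain z c where z: "(z, c) \<in> X \<inter> Y" by auto
    have XY: "X \<inter> Y = right_ideal ZZ (z, lcm a b)"
      using right_ideal_inter X Y z by simp
    have "lcm a b dvd x - z \<longleftrightarrow> a dvd x - m \<and> b dvd x - n"
    proof -
      have "a dvd z - m" "b dvd z - n" using z X Y by (simp_all add: right_ideal_ZZ)
      then have "a dvd x - m \<longleftrightarrow> a dvd x - z" "b dvd x - n \<longleftrightarrow> b dvd x - z"
        using dvd_add_left_iff[of a "z - m" "x - z"] dvd_add_left_iff[of b "z - n" "x - z"] by simp_all
      then show ?thesis by (simp add: lcm_least_iff)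
    qed
    then show ?thesis
      using range_proj_residue[OF N(1) _ N(4), of z x] X Y XY by (simp add: e_right_ideal lcm_eq_0_iff)
  qed
  show ?thesis
  proof (rule residue_eqI[OF N(1)])
    fix x
    show "e X * e Y * range_proj (x, int N) = e (X \<inter> Y) * range_proj (x, int N)"
      unfolding mult.assoc eY eXY by (simp add: eX)
  qed
qed

lemma prod_residue:
  assumes N: "0 < N" and ps: "\<forall>p\<in>set ps. snd p \<noteq> 0 \<and> snd p dvd int N"
  shows "prod_list (map (\<lambda>p. 1 - range_proj p) ps) * range_proj (x, int N)
    = (if \<exists>p\<in>set ps. snd p dvd x - fst p then 0 else range_proj (x, int N))"
  using ps
proof (induction ps)
  case (Cons p ps)
  have p: "range_proj p * range_proj (x, int N) = (if snd p dvd x - fst p then range_proj (x, int N) else 0)"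
    using range_proj_residue[OF N, of "snd p" "fst p" x] Cons.prems by simp
  show ?case
    using Cons by (simp add: mult.assoc left_diff_distrib p)
qed simp

text \<open>Modulo a common multiple \<open>N\<close> of the moduli, the product is diagonal with entry \<open>1\<close> exactly at the
  residues that lie in none of the classes. A foundation set leaves no such residue: testing it against
  the ideal of \<open>(x, N)\<close> yields a class that contains \<open>x\<close>.\<close>

lemma e_foundation:
  assumes F: "foundation_set ZZ (set ps)"
  shows "prod_list (map (\<lambda>p. 1 - e (right_ideal ZZ p)) ps) = 0"
proof -
  have ps: "p \<in> carrier ZZ" "snd p \<noteq> 0" if "p \<in> set ps" for p
    using F that by (auto simp: foundation_set_def ZZ_def)
  define N where "N = nat \<bar>\<Prod>p\<in>set ps. snd p\<bar>"
  have N: "0 < N"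
    using ps(2) by (simp add: N_def)
  have dvd: "snd p dvd int N" if "p \<in> set ps" for p
    using that by (simp add: N_def dvd_prodI)
  have "prod_list (map (\<lambda>p. 1 - e (right_ideal ZZ p)) ps) = prod_list (map (\<lambda>p. 1 - range_proj p) ps)"
    using ps(1) by (intro arg_cong[where f = prod_list] map_cong) (simp_all add: e_right_ideal)
  also have "\<dots> = 0"
  proof (rule residue_eqI[OF N])
    fix x
    have "(x, int N) \<in> carrier ZZ" using N by simp
    then obtain p where p: "p \<in> set ps" "right_ideal ZZ (x, int N) \<inter> right_ideal ZZ p \<noteq> {}"
      using F unfolding foundation_set_def by blast
    then obtain y c where y: "(y, c) \<in> right_ideal ZZ (x, int N)" "(y, c) \<in> right_ideal ZZ (fst p, snd p)"
      by auto
    then have yx: "int N dvd y - x" and yp: "snd p dvd y - fst p"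
      using N ps(2)[OF p(1)] right_ideal_ZZ[of "snd p" "fst p"] by (simp_all add: right_ideal_ZZ)
    have "snd p dvd (y - fst p) - (y - x)"
      by (rule dvd_diff[OF yp dvd_trans[OF dvd[OF p(1)] yx]])
    then have "snd p dvd x - fst p" by simp
    then show "prod_list (map (\<lambda>p. 1 - range_proj p) ps) * range_proj (x, int N) = 0 * range_proj (x, int N)"
      using prod_residue[OF N, of ps x] ps(2) dvd p(1) by auto
  qed
  finally show ?thesis .
qed

theorem bq_relations_w_e: "bq_relations w e"
proof
  fix p X assume p: "p \<in> carrier ZZ" and X: "X \<in> constructible_ideals ZZ"
  show "w p * e X * adjoint (w p) = e (translate ZZ p X)"
    using X
  proof (cases rule: constructible_cases)
    case empty
    then show ?thesis by (simp add: e_empty translate_def)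
  next
    case (ideal m a)
    then show ?thesis
      using p by (simp add: e_right_ideal translate_right_ideal range_proj_conj ZZ_mult_closed)
  qed
next
  fix X assume "X \<in> constructible_ideals ZZ"
  then show "projection (e X)"
  proof (cases rule: constructible_cases)
    case empty
    then show ?thesis by (simp add: e_empty projection_def)
  next
    case (ideal m a)
    then show ?thesis by (simp add: e_right_ideal range_proj_projection)
  qed
next
  show "e (carrier ZZ) = 1"
    using e_right_ideal[of "(0, 1)"] by (simp add: right_ideal_one range_proj_def w_one)
qed (simp_all add: w_isometry w_mult e_empty e_mult e_foundation)

end

section \<open>Evaluation of the presentations in a star-ring\<close>

definition star_hom :: "('g star_poly \<Rightarrow> 'a::star_ring) \<Rightarrow> bool" where
  "star_hom \<Phi> \<longleftrightarrow> \<Phi> 1 = 1 \<and> (\<forall>x y. \<Phi> (x + y) = \<Phi> x + \<Phi> y \<and> \<Phi> (x * y) = \<Phi> x * \<Phi> y \<and> \<Phi> (adj x) = adjoint (\<Phi> x))"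

lemma star_hom_simps:
  assumes "star_hom \<Phi>"
  shows "\<Phi> 1 = 1" "\<Phi> (x + y) = \<Phi> x + \<Phi> y" "\<Phi> (x * y) = \<Phi> x * \<Phi> y" "\<Phi> (adj x) = adjoint (\<Phi> x)"
    and "\<Phi> 0 = 0" "\<Phi> (x - y) = \<Phi> x - \<Phi> y" "\<Phi> (x ^ n) = \<Phi> x ^ n" "\<Phi> (upow x k) = upower (\<Phi> x) k"
    and "\<Phi> (sum f I) = (\<Sum>i\<in>I. \<Phi> (f i))" "\<Phi> (prod_list xs) = prod_list (map \<Phi> xs)"
proof -
  have one: "\<Phi> 1 = 1" and add: "\<Phi> (x + y) = \<Phi> x + \<Phi> y" and mult: "\<Phi> (x * y) = \<Phi> x * \<Phi> y"
    and adj: "\<Phi> (adj x) = adjoint (\<Phi> x)" for x y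
    using assms by (simp_all add: star_hom_def)
  show "\<Phi> 1 = 1" "\<Phi> (x + y) = \<Phi> x + \<Phi> y" "\<Phi> (x * y) = \<Phi> x * \<Phi> y" "\<Phi> (adj x) = adjoint (\<Phi> x)"
    by (fact one add mult adj)+
  show zero: "\<Phi> 0 = 0" using add[of 0 0] by simp
  show "\<Phi> (x - y) = \<Phi> x - \<Phi> y" using add[of "x - y" y] by (simp add: eq_diff_eq)
  have power: "\<Phi> (x ^ n) = \<Phi> x ^ n" for x n
    by (induction n) (simp_all add: one mult)
  show "\<Phi> (x ^ n) = \<Phi> x ^ n" by (rule power)
  show "\<Phi> (upow x k) = upower (\<Phi> x) k"
    by (simp add: upow_def upower_def power adj)
  show "\<Phi> (sum f I) = (\<Sum>i\<in>I. \<Phi> (f i))"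
    by (induction I rule: infinite_finite_induct) (simp_all add: zero add)
  show "\<Phi> (prod_list xs) = prod_list (map \<Phi> xs)"
    by (induction xs) (simp_all add: one mult)
qed

lemma star_hom_subst: "star_hom \<Phi> \<Longrightarrow> star_hom (\<lambda>x. \<Phi> (subst f x))"
  by (simp add: star_hom_def)

lemma ball_image_collect:
  "(\<forall>r\<in>{f a |a. P a}. Q r) \<longleftrightarrow> (\<forall>a. P a \<longrightarrow> Q (f a))"
  "(\<forall>r\<in>{g a b |a b. P' a b}. Q r) \<longleftrightarrow> (\<forall>a b. P' a b \<longrightarrow> Q (g a b))"
  by blast+

lemma ball_insert_iff: "(\<forall>r\<in>{a, b}. Q r) \<longleftrightarrow> Q a \<and> Q b"
  by simp

lemma qz_rels_iff:
  assumes "star_hom \<Phi>"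
  shows "(\<forall>r\<in>qz_rels. \<Phi> r = 0) \<longleftrightarrow> qz_relations (\<Phi> (gen S)) (\<lambda>a. \<Phi> (gen (V a)))"
proof -
  have "(\<forall>r\<in>qz_rels. \<Phi> r = 0) \<longleftrightarrow>
     \<Phi> (adj (gen S) * gen S - 1) = 0 \<and> \<Phi> (gen S * adj (gen S) - 1) = 0 \<and>
     (\<forall>a. a \<noteq> 0 \<longrightarrow> \<Phi> (adj (gen (V a)) * gen (V a) - 1) = 0) \<and>
     (\<forall>a b. a \<noteq> 0 \<and> b \<noteq> 0 \<longrightarrow> \<Phi> (gen (V a) * gen (V b) - gen (V (a * b))) = 0) \<and>
     (\<forall>a. a \<noteq> 0 \<longrightarrow> \<Phi> (gen (V a) * gen S - upow (gen S) a * gen (V a)) = 0) \<and>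
     (\<forall>a. a \<noteq> 0 \<longrightarrow> \<Phi> (gen (V a) * adj (gen S) - upow (adj (gen S)) a * gen (V a)) = 0) \<and>
     (\<forall>a. a \<noteq> 0 \<longrightarrow> \<Phi> ((\<Sum>j<nat \<bar>a\<bar>. gen S ^ j * gen (V a) * adj (gen (V a)) * adj (gen S) ^ j) - 1) = 0)"
    by (simp only: qz_rels_def Let_def ball_Un ball_image_collect ball_insert_iff conj_assoc)
  then show ?thesis
    by (simp add: star_hom_simps[OF assms] qz_relations_def unitary_def imp_conjL)
qed

lemma bq_rels_iff:
  assumes "star_hom \<Phi>"
  shows "(\<forall>r\<in>bq_rels ZZ. \<Phi> r = 0) \<longleftrightarrow> bq_relations (\<lambda>p. \<Phi> (gen (W p))) (\<lambda>X. \<Phi> (gen (E X)))"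
proof -
  let ?J = "constructible_ideals ZZ" and ?w = "\<lambda>p. gen (W p)" and ?e = "\<lambda>X. gen (E X)"
  have "(\<forall>r\<in>bq_rels ZZ. \<Phi> r = 0) \<longleftrightarrow>
     (\<forall>p. p \<in> carrier ZZ \<longrightarrow> \<Phi> (adj (?w p) * ?w p - 1) = 0) \<and>
     (\<forall>X. X \<in> ?J \<longrightarrow> \<Phi> (adj (?e X) - ?e X) = 0) \<and>
     (\<forall>X. X \<in> ?J \<longrightarrow> \<Phi> (?e X * ?e X - ?e X) = 0) \<and>
     (\<forall>p q. p \<in> carrier ZZ \<and> q \<in> carrier ZZ \<longrightarrow> \<Phi> (?w p * ?w q - ?w (p \<otimes>\<^bsub>ZZ\<^esub> q)) = 0) \<and>
     (\<forall>p X. p \<in> carrier ZZ \<and> X \<in> ?J \<longrightarrow> \<Phi> (?w p * ?e X * adj (?w p) - ?e (translate ZZ p X)) = 0) \<and>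
     \<Phi> (?e (carrier ZZ) - 1) = 0 \<and> \<Phi> (?e {}) = 0 \<and>
     (\<forall>X Y. X \<in> ?J \<and> Y \<in> ?J \<longrightarrow> \<Phi> (?e X * ?e Y - ?e (X \<inter> Y)) = 0) \<and>
     (\<forall>ps. distinct ps \<and> foundation_set ZZ (set ps) \<longrightarrow>
        \<Phi> (prod_list (map (\<lambda>p. 1 - ?e (right_ideal ZZ p)) ps)) = 0)"
    by (simp only: bq_rels_def Let_def ball_Un ball_image_collect ball_insert_iff conj_assoc)
  then show ?thesis
    by (simp add: star_hom_simps[OF assms] bq_relations_def projection_def comp_def imp_conjL
        all_conj_distrib imp_conjR conj_assoc)
qed

section \<open>The star-rings of the two presentations\<close>

text \<open>Equality under every C*-seminorm that respects the relations. Taking all elements of the generator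
  type as generators makes this a congruence on a whole type, so that its quotient is a star-ring in which
  the relations are equations; \<open>null_eq_free\<close> returns to the given set of generators.\<close>

definition null_eq :: "'g star_poly set \<Rightarrow> 'g star_poly \<Rightarrow> 'g star_poly \<Rightarrow> bool" where
  "null_eq R x y \<longleftrightarrow> (\<forall>p. cstar_seminorm UNIV R p \<longrightarrow> p (x - y) = 0)"

lemma null_eqD: "null_eq R x y \<Longrightarrow> cstar_seminorm UNIV R p \<Longrightarrow> p (x - y) = 0"
  by (simp add: null_eq_def)

lemma null_eq_seminorm: "null_eq R x y \<Longrightarrow> cstar_seminorm UNIV R p \<Longrightarrow> p x = p y"
  using cstar_seminorm_eq[of UNIV R p x y] by (simp add: null_eqD)

lemma null_eq_refl: "null_eq R x x"
  by (simp add: null_eq_def cstar_seminorm_zero)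

lemma null_eq_controlled:
  assumes "\<And>p. cstar_seminorm UNIV R p \<Longrightarrow> p (x - y) \<le> 0"
  shows "null_eq R x y"
  using assms cstar_seminorm_nonneg[of UNIV R _ "x - y"] by (auto simp: null_eq_def intro: antisym)

lemma null_eq_rel: "r \<in> R \<Longrightarrow> null_eq R r 0"
  by (simp add: null_eq_def cstar_seminormD(5))

lemma null_eq_add: "null_eq R x x' \<Longrightarrow> null_eq R y y' \<Longrightarrow> null_eq R (x + y) (x' + y')"
proof (rule null_eq_controlled)
  fix p assume *: "null_eq R x x'" "null_eq R y y'" and p: "cstar_seminorm UNIV R p"
  have eq: "x + y - (x' + y') = (x - x') + (y - y')" by simp
  show "p (x + y - (x' + y')) \<le> 0"
    unfolding eq using cstar_seminormD(1)[OF p, of "x - x'" "y - y'"] *[THEN null_eqD, OF p] by simp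
qed

lemma null_eq_mult: "null_eq R x x' \<Longrightarrow> null_eq R y y' \<Longrightarrow> null_eq R (x * y) (x' * y')"
proof (rule null_eq_controlled)
  fix p assume *: "null_eq R x x'" "null_eq R y y'" and p: "cstar_seminorm UNIV R p"
  have "x * y - x' * y' = (x - x') * y + x' * (y - y')"
    by (simp add: left_diff_distrib right_diff_distrib)
  then have "p (x * y - x' * y') \<le> p ((x - x') * y) + p (x' * (y - y'))"
    using cstar_seminormD(1)[OF p, of "(x - x') * y" "x' * (y - y')"] by simp
  also have "\<dots> \<le> p (x - x') * p y + p x' * p (y - y')"
    by (intro add_mono cstar_seminormD(2)[OF p]) simp_all
  finally show "p (x * y - x' * y') \<le> 0"
    using *[THEN null_eqD, OF p] by simp
qed

lemma null_eq_adj: "null_eq R x x' \<Longrightarrow> null_eq R (adj x) (adj x')"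
  unfolding null_eq_def using cstar_seminorm_adj[of UNIV R _ "x - x'"]
  by (metis UNIV_I adj_diff free_alg_UNIV)

lemma null_eq_uminus: "null_eq R x x' \<Longrightarrow> null_eq R (- x) (- x')"
  using null_eq_mult[OF null_eq_refl[of R "- 1"]] by fastforce

lemma null_eq_diff: "null_eq R x x' \<Longrightarrow> null_eq R y y' \<Longrightarrow> null_eq R (x - y) (x' - y')"
  using null_eq_add[OF _ null_eq_uminus[of R y y']] by fastforce

lemma equivp_null_eq: "equivp (null_eq R)"
proof (rule equivpI)
  show "reflp (null_eq R)" by (simp add: reflp_def null_eq_refl)
  show "symp (null_eq R)"
    using cstar_seminorm_uminus[of UNIV R] by (intro sympI) (metis UNIV_I free_alg_UNIV minus_diff_eq null_eq_def)
  show "transp (null_eq R)"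
  proof (rule transpI)
    fix x y z assume "null_eq R x y" "null_eq R y z"
    from null_eq_add[OF this] show "null_eq R x z"
      by (simp add: null_eq_def)
  qed
qed

lemma retraction_id: "x \<in> free_alg G \<Longrightarrow> subst (\<lambda>g. if g \<in> G then gen g else 0) x = x"
  by (induction rule: free_alg_induct) simp_all

text \<open>Sending the generators outside \<open>G\<close> to \<open>0\<close> is a star-homomorphism that fixes the relations, so
  every C*-seminorm of the presentation on \<open>G\<close> extends to the whole generator type.\<close>

lemma null_eq_free:
  assumes "null_eq R x y" and R: "R \<subseteq> free_alg G" and xy: "x \<in> free_alg G" "y \<in> free_alg G"
    and p: "cstar_seminorm G R p"
  shows "p (x - y) = 0"
proof -
  let ?c = "\<lambda>g. if g \<in> G then gen g else 0"
  have "cstar_seminorm UNIV R (\<lambda>x. p (subst ?c x))"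
  proof (rule cstar_seminorm_subst[OF p])
    fix r assume r: "r \<in> R"
    then have "subst ?c r = r" using R by (intro retraction_id) auto
    then show "p (subst ?c r) = 0" using cstar_seminormD(5)[OF p r] by simp
  qed simp
  from null_eqD[OF assms(1) this] show ?thesis
    by (simp add: retraction_id xy)
qed

quotient_type qz_alg = "qz_gen star_poly" / "null_eq qz_rels"
  by (rule equivp_null_eq)

instantiation qz_alg :: star_ring
begin
lift_definition zero_qz_alg :: qz_alg is 0 .
lift_definition one_qz_alg :: qz_alg is 1 .
lift_definition plus_qz_alg :: "qz_alg \<Rightarrow> qz_alg \<Rightarrow> qz_alg" is "(+)" by (rule null_eq_add)
lift_definition minus_qz_alg :: "qz_alg \<Rightarrow> qz_alg \<Rightarrow> qz_alg" is "(-)" by (rule null_eq_diff)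
lift_definition uminus_qz_alg :: "qz_alg \<Rightarrow> qz_alg" is uminus by (rule null_eq_uminus)
lift_definition times_qz_alg :: "qz_alg \<Rightarrow> qz_alg \<Rightarrow> qz_alg" is "(*)" by (rule null_eq_mult)
lift_definition adjoint_qz_alg :: "qz_alg \<Rightarrow> qz_alg" is adj by (rule null_eq_adj)
instance
  by standard (transfer; simp add: null_eq_refl algebra_simps)+
end

quotient_type bq_alg = "(int \<times> int) bq_gen star_poly" / "null_eq (bq_rels ZZ)"
  by (rule equivp_null_eq)

instantiation bq_alg :: star_ring
begin
lift_definition zero_bq_alg :: bq_alg is 0 .
lift_definition one_bq_alg :: bq_alg is 1 .
lift_definition plus_bq_alg :: "bq_alg \<Rightarrow> bq_alg \<Rightarrow> bq_alg" is "(+)" by (rule null_eq_add)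
lift_definition minus_bq_alg :: "bq_alg \<Rightarrow> bq_alg \<Rightarrow> bq_alg" is "(-)" by (rule null_eq_diff)
lift_definition uminus_bq_alg :: "bq_alg \<Rightarrow> bq_alg" is uminus by (rule null_eq_uminus)
lift_definition times_bq_alg :: "bq_alg \<Rightarrow> bq_alg \<Rightarrow> bq_alg" is "(*)" by (rule null_eq_mult)
lift_definition adjoint_bq_alg :: "bq_alg \<Rightarrow> bq_alg" is adj by (rule null_eq_adj)
instance
  by standard (transfer; simp add: null_eq_refl algebra_simps)+
end

lemma star_hom_abs_qz: "star_hom abs_qz_alg"
  by (simp add: star_hom_def one_qz_alg_def plus_qz_alg.abs_eq times_qz_alg.abs_eq adjoint_qz_alg.abs_eq)

lemma star_hom_abs_bq: "star_hom abs_bq_alg"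
  by (simp add: star_hom_def one_bq_alg_def plus_bq_alg.abs_eq times_bq_alg.abs_eq adjoint_bq_alg.abs_eq)

lemma abs_qz_rel: "r \<in> qz_rels \<Longrightarrow> abs_qz_alg r = 0"
  by (simp add: zero_qz_alg_def qz_alg.abs_eq_iff null_eq_rel)

lemma abs_bq_rel: "r \<in> bq_rels ZZ \<Longrightarrow> abs_bq_alg r = 0"
  by (simp add: zero_bq_alg_def bq_alg.abs_eq_iff null_eq_rel)

lemma qz_alg_seminorm:
  assumes p: "cstar_seminorm UNIV qz_rels p"
  shows "cstar_seminorm_ring (\<lambda>t. p (rep_qz_alg t)) (\<lambda>c. abs_qz_alg (scal c))"
proof -
  have q: "p (rep_qz_alg (abs_qz_alg x)) = p x" for x
    by (rule null_eq_seminorm[OF Quotient3_rep_abs[OF Quotient3_qz_alg null_eq_refl] p])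
  note hom = star_hom_simps[OF star_hom_abs_qz, symmetric]
  note D = cstar_seminormD[OF p]
  show ?thesis
  proof
    fix x y :: qz_alg and c d :: complex
    obtain x' y' where xy: "x = abs_qz_alg x'" "y = abs_qz_alg y'"
      by (metis Quotient3_abs_rep Quotient3_qz_alg)
    show "abs_qz_alg (scal (c + d)) = abs_qz_alg (scal c) + abs_qz_alg (scal d)"
      "abs_qz_alg (scal (c * d)) = abs_qz_alg (scal c) * abs_qz_alg (scal d)"
      "abs_qz_alg (scal 1) = 1"
      "x * abs_qz_alg (scal c) = abs_qz_alg (scal c) * x"
      "adjoint (abs_qz_alg (scal c)) = abs_qz_alg (scal (cnj c))"
      unfolding xy hom by (simp_all only: scal_add scal_mult scal_1 scal_commute[of x'] adj_scal)
    show "p (rep_qz_alg (x + y)) \<le> p (rep_qz_alg x) + p (rep_qz_alg y)"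
      "p (rep_qz_alg (x * y)) \<le> p (rep_qz_alg x) * p (rep_qz_alg y)"
      "p (rep_qz_alg (abs_qz_alg (scal c) * x)) = cmod c * p (rep_qz_alg x)"
      "p (rep_qz_alg (adjoint x * x)) = (p (rep_qz_alg x))\<^sup>2"
      unfolding xy hom q by (simp_all add: D)
  qed
qed

text \<open>Every C*-seminorm kills \<open>f\<^sub>i f\<^sub>j\<close>, and in this quotient only \<open>0\<close> is killed by all of them.\<close>

lemma qz_alg_orthogonal:
  fixes f :: "nat \<Rightarrow> qz_alg"
  assumes "finite I" "\<And>i. i \<in> I \<Longrightarrow> projection (f i)" "sum f I = 1" "i \<in> I" "j \<in> I" "i \<noteq> j"
  shows "f i * f j = 0"
proof -
  have "null_eq qz_rels (rep_qz_alg (f i * f j)) 0"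
    unfolding null_eq_def
  proof (intro allI impI)
    fix p assume p: "cstar_seminorm UNIV qz_rels p"
    interpret cstar_seminorm_ring "\<lambda>t. p (rep_qz_alg t)" "\<lambda>c. abs_qz_alg (scal c)"
      by (rule qz_alg_seminorm[OF p])
    show "p (rep_qz_alg (f i * f j) - 0) = 0"
      using sum_projections_orthogonal[OF assms(1-3,5,4)] assms(6) by simp
  qed
  then have "abs_qz_alg (rep_qz_alg (f i * f j)) = 0"
    by (simp add: zero_qz_alg_def qz_alg.abs_eq_iff)
  then show ?thesis
    by (simp only: Quotient3_abs_rep[OF Quotient3_qz_alg])
qed

section \<open>The isomorphism\<close>

lemma constructible_translate:
  assumes "p \<in> carrier ZZ" "X \<in> constructible_ideals ZZ"
  shows "translate ZZ p X \<in> constructible_ideals ZZ"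
  using assms(2)
proof (cases rule: constructible_cases)
  case empty
  then show ?thesis by (simp add: translate_def constructible_ideals_def)
next
  case (ideal m a)
  then have "translate ZZ p X = right_ideal ZZ (p \<otimes>\<^bsub>ZZ\<^esub> (m, a))" "p \<otimes>\<^bsub>ZZ\<^esub> (m, a) \<in> carrier ZZ"
    using assms(1) by (auto simp: translate_right_ideal ZZ_mult_closed)
  then show ?thesis by (simp add: constructible_ideals_def)
qed

lemma constructible_Int:
  assumes "X \<in> constructible_ideals ZZ" "Y \<in> constructible_ideals ZZ"
  shows "X \<inter> Y \<in> constructible_ideals ZZ"
proof (cases "X \<inter> Y = {}")
  case True
  then show ?thesis by (simp add: constructible_ideals_def)
next
  case False
  then obtain m a where X: "X = right_ideal ZZ (m, a)" "a \<noteq> 0"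
    using constructible_cases[OF assms(1)] by (metis Int_empty_left)
  obtain n b where Y: "Y = right_ideal ZZ (n, b)" "b \<noteq> 0"
    using constructible_cases[OF assms(2)] False by (metis Int_empty_right)
  obtain z c where "(z, c) \<in> X \<inter> Y" using False by auto
  then have "X \<inter> Y = right_ideal ZZ (z, lcm a b)"
    using right_ideal_inter[OF X(2) Y(2)] X(1) Y(1) by blast
  then show ?thesis
    using X(2) Y(2) by (auto simp: constructible_ideals_def lcm_eq_0_iff intro!: imageI)
qed

lemma upow_free: "x \<in> free_alg G \<Longrightarrow> upow x k \<in> free_alg G"
  by (simp add: upow_def free_alg_power free_alg_adj)

lemma qz_rels_free: "qz_rels \<subseteq> free_alg qz_gens"
  by (auto simp: qz_rels_def Let_def qz_gens_def adj_gen_free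
      intro!: free_alg_diff free_alg_mult free_alg_sum free_alg_power upow_free)

lemma bq_gens_simps:
  "W p \<in> bq_gens P \<longleftrightarrow> p \<in> carrier P"
  "E X \<in> bq_gens P \<longleftrightarrow> X \<in> constructible_ideals P"
  by (auto simp: bq_gens_def)

lemma bq_rels_free: "bq_rels ZZ \<subseteq> free_alg (bq_gens ZZ)"
proof -
  have "right_ideal ZZ p \<in> constructible_ideals ZZ" if "p \<in> carrier ZZ" for p
    using that by (simp add: constructible_ideals_def)
  moreover have "carrier ZZ \<in> constructible_ideals ZZ"
    unfolding right_ideal_one[symmetric] constructible_ideals_def
    by (intro UnI1 imageI right_ideal_self) simp
  moreover have "{} \<in> constructible_ideals ZZ"
    by (simp add: constructible_ideals_def)
  ultimately show ?thesis
    unfolding bq_rels_def Let_def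
    by (auto simp: bq_gens_simps adj_gen_free ZZ_mult_closed constructible_translate
        constructible_Int foundation_set_def subset_iff
        intro!: free_alg_diff free_alg_mult free_alg_prod_list)
qed

definition to_bq :: "qz_gen \<Rightarrow> (int \<times> int) bq_gen star_poly" where
  "to_bq g = (case g of S \<Rightarrow> gen (W (1, 1)) | V a \<Rightarrow> gen (W (0, a)))"

definition qz_w :: "int \<times> int \<Rightarrow> qz_gen star_poly" where
  "qz_w p = upow (gen S) (fst p) * gen (V (snd p))"

definition to_qz :: "(int \<times> int) bq_gen \<Rightarrow> qz_gen star_poly" where
  "to_qz h = (case h of W p \<Rightarrow> qz_w p
    | E X \<Rightarrow> if X = {} then 0 else let p = (SOME p. p \<in> carrier ZZ \<and> X = right_ideal ZZ p) in qz_w p * adj (qz_w p))"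

lemma to_bq_free: "g \<in> qz_gens \<Longrightarrow> to_bq g \<in> free_alg (bq_gens ZZ)"
  by (auto simp: qz_gens_def to_bq_def bq_gens_def)

lemma qz_w_free: "p \<in> carrier ZZ \<Longrightarrow> qz_w p \<in> free_alg qz_gens"
  by (cases p) (auto simp: qz_w_def qz_gens_def intro!: free_alg_mult upow_free)

lemma some_generator:
  assumes "X \<in> constructible_ideals ZZ" "X \<noteq> {}"
  defines "q \<equiv> SOME p. p \<in> carrier ZZ \<and> X = right_ideal ZZ p"
  shows "q \<in> carrier ZZ" "X = right_ideal ZZ q"
proof -
  have "\<exists>p. p \<in> carrier ZZ \<and> X = right_ideal ZZ p"
    using assms(1,2) unfolding constructible_ideals_def by blast
  from someI_ex[OF this] show "q \<in> carrier ZZ" "X = right_ideal ZZ q"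
    by (auto simp: q_def)
qed

lemma to_qz_free: "h \<in> bq_gens ZZ \<Longrightarrow> to_qz h \<in> free_alg qz_gens"
  by (cases h) (simp_all add: bq_gens_def image_iff to_qz_def Let_def qz_w_free free_alg_mult free_alg_adj some_generator(1))

lemma subst_to_bq_free: "x \<in> free_alg qz_gens \<Longrightarrow> subst to_bq x \<in> free_alg (bq_gens ZZ)"
  by (rule subst_free[OF to_bq_free])

lemma subst_to_qz_free: "y \<in> free_alg (bq_gens ZZ) \<Longrightarrow> subst to_qz y \<in> free_alg qz_gens"
  by (rule subst_free[OF to_qz_free])

interpretation qz: qz_relations_orthogonal "abs_qz_alg (gen S)" "\<lambda>a. abs_qz_alg (gen (V a))"
proof (intro qz_relations_orthogonal.intro qz_relations_orthogonal_axioms.intro)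
  show "qz_relations (abs_qz_alg (gen S)) (\<lambda>a. abs_qz_alg (gen (V a)))"
    using abs_qz_rel by (simp flip: qz_rels_iff[OF star_hom_abs_qz])
qed (rule qz_alg_orthogonal)

interpretation bq: bq_relations "\<lambda>p. abs_bq_alg (gen (W p))" "\<lambda>X. abs_bq_alg (gen (E X))"
  using abs_bq_rel by (simp flip: bq_rels_iff[OF star_hom_abs_bq])

lemma abs_qz_w: "abs_qz_alg (qz_w p) = qz.w p"
  by (simp add: qz_w_def qz.w_def star_hom_simps[OF star_hom_abs_qz])

lemma abs_to_qz: "abs_qz_alg (to_qz (W p)) = qz.w p" "abs_qz_alg (to_qz (E X)) = qz.e X"
  by (simp_all add: to_qz_def qz.e_def qz.range_proj_def Let_def abs_qz_w star_hom_simps[OF star_hom_abs_qz])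

lemma abs_subst_to_qz: "r \<in> bq_rels ZZ \<Longrightarrow> abs_qz_alg (subst to_qz r) = 0"
  using bq_rels_iff[OF star_hom_subst[OF star_hom_abs_qz], of to_qz] qz.bq_relations_w_e
  by (simp add: abs_to_qz)

lemma abs_subst_to_bq: "r \<in> qz_rels \<Longrightarrow> abs_bq_alg (subst to_bq r) = 0"
  using qz_rels_iff[OF star_hom_subst[OF star_hom_abs_bq], of to_bq] bq.qz_relations_w
  by (simp add: to_bq_def)

lemma abs_qz_eqD:
  assumes "abs_qz_alg x = abs_qz_alg y" "x \<in> free_alg qz_gens" "y \<in> free_alg qz_gens"
    "cstar_seminorm qz_gens qz_rels p"
  shows "p (x - y) = 0"
  using assms null_eq_free[OF _ qz_rels_free] by (simp add: qz_alg.abs_eq_iff)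

lemma abs_bq_eqD:
  assumes "abs_bq_alg x = abs_bq_alg y" "x \<in> free_alg (bq_gens ZZ)" "y \<in> free_alg (bq_gens ZZ)"
    "cstar_seminorm (bq_gens ZZ) (bq_rels ZZ) p"
  shows "p (x - y) = 0"
  using assms null_eq_free[OF _ bq_rels_free] by (simp add: bq_alg.abs_eq_iff)

interpretation QB: presentation_iso qz_gens qz_rels "bq_gens ZZ" "bq_rels ZZ" to_bq to_qz
proof
  fix g p assume p: "cstar_seminorm qz_gens qz_rels p" and g: "g \<in> qz_gens"
  have "abs_qz_alg (subst to_qz (to_bq g)) = abs_qz_alg (gen g)"
    using qz.w_one by (cases g) (simp_all add: to_bq_def abs_to_qz qz.w_def)
  then show "p (subst to_qz (to_bq g) - gen g) = 0"
    using g by (intro abs_qz_eqD[OF _ _ _ p] subst_to_qz_free to_bq_free) simp_all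
next
  fix h p assume p: "cstar_seminorm (bq_gens ZZ) (bq_rels ZZ) p" and h: "h \<in> bq_gens ZZ"
  note hom = star_hom_simps[OF star_hom_abs_bq]
  have w: "abs_bq_alg (subst to_bq (qz_w q)) = abs_bq_alg (gen (W q))" if "q \<in> carrier ZZ" for q
    using that bq.w_factor[of "snd q" "fst q"] star_hom_simps(8)[OF star_hom_subst[OF star_hom_abs_bq, of to_bq]]
    by (cases q) (simp add: qz_w_def to_bq_def hom)
  have "abs_bq_alg (subst to_bq (to_qz h)) = abs_bq_alg (gen h)"
  proof (cases h)
    case (W q)
    then show ?thesis using h w by (auto simp: to_qz_def bq_gens_def)
  next
    case (E X)
    show ?thesis
    proof (cases "X = {}")
      case True
      then show ?thesis using E bq.e_empty by (simp add: to_qz_def hom)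
    next
      case False
      define q where "q = (SOME p. p \<in> carrier ZZ \<and> X = right_ideal ZZ p)"
      have "X \<in> constructible_ideals ZZ" using E h by (auto simp: bq_gens_def)
      then have q: "q \<in> carrier ZZ" "X = right_ideal ZZ q"
        using some_generator[OF _ False] by (auto simp: q_def)
      have "abs_bq_alg (subst to_bq (to_qz h)) = abs_bq_alg (gen (W q)) * adjoint (abs_bq_alg (gen (W q)))"
        using E False w[OF q(1)] by (simp add: to_qz_def Let_def hom flip: q_def)
      then show ?thesis
        using bq.range_projection[OF q(1)] q(2) E by simp
    qed
  qed
  then show "p (subst to_bq (to_qz h) - gen h) = 0"
    using h by (intro abs_bq_eqD[OF _ _ _ p] subst_to_bq_free to_qz_free) simp_all
next
  fix q r assume q: "cstar_seminorm (bq_gens ZZ) (bq_rels ZZ) q" and r: "r \<in> qz_rels"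
  have "subst to_bq r \<in> free_alg (bq_gens ZZ)"
    using r qz_rels_free by (intro subst_to_bq_free) auto
  then show "q (subst to_bq r) = 0"
    using abs_bq_eqD[OF _ _ free_alg_simps(2) q, of "subst to_bq r"] abs_subst_to_bq[OF r]
    by (simp add: star_hom_simps[OF star_hom_abs_bq])
next
  fix p r assume p: "cstar_seminorm qz_gens qz_rels p" and r: "r \<in> bq_rels ZZ"
  have "subst to_qz r \<in> free_alg qz_gens"
    using r bq_rels_free by (intro subst_to_qz_free) auto
  then show "p (subst to_qz r) = 0"
    using abs_qz_eqD[OF _ _ free_alg_simps(2) p, of "subst to_qz r"] abs_subst_to_qz[OF r]
    by (simp add: star_hom_simps[OF star_hom_abs_qz])
qed (rule QZ_admissible BQ_admissible to_bq_free to_qz_free; assumption)+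

lemma induced_const:
  "x \<in> free_alg qz_gens \<Longrightarrow> QB.induced (univ_class qz_gens qz_rels (\<lambda>_. x))
     = univ_class (bq_gens ZZ) (bq_rels ZZ) (\<lambda>_. subst to_bq x)"
  by (rule QB.induced_cls[OF QB.src.seqs_const])

theorem proposition6p6:
  shows "\<exists>\<phi> \<in> cstar_iso QZ (BQ ZZ).
           \<phi> qz_s = zz_s (1, 1) \<and>
           (\<forall>a::int. a \<noteq> 0 \<longrightarrow> \<phi> (qz_v a) = zz_s (0, a div \<bar>a\<bar>) \<otimes>\<^bsub>BQ ZZ\<^esub> zz_t (0, \<bar>a\<bar>))"
proof (intro bexI conjI allI impI)
  show "QB.induced \<in> cstar_iso QZ (BQ ZZ)"
    unfolding QZ_def BQ_def by (rule QB.induced_iso)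
  have "gen S \<in> free_alg qz_gens" by (simp add: qz_gens_def)
  then show "QB.induced qz_s = zz_s (1, 1)"
    by (simp add: qz_s_def univ_gen_def induced_const to_bq_def zz_s_def zz_A_def bq_w_def)
  fix a :: int assume a: "a \<noteq> 0"
  let ?\<sigma> = "(0, a div \<bar>a\<bar>) :: int \<times> int" and ?\<tau> = "(0, \<bar>a\<bar>) :: int \<times> int"
  have factor: "a div \<bar>a\<bar> * \<bar>a\<bar> = a" by simp
  have "\<bar>a div \<bar>a\<bar>\<bar> * \<bar>a\<bar> = 1 * \<bar>a\<bar>"
    using arg_cong[OF factor, of abs] by (simp only: abs_mult abs_abs mult_1)
  then have sgn: "a div \<bar>a\<bar> = 1 \<or> a div \<bar>a\<bar> = - 1"
    using a unfolding mult_cancel_right by linarith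
  then have carr: "?\<sigma> \<in> carrier ZZ" "?\<tau> \<in> carrier ZZ" using a by auto
  have const: "(\<lambda>_. gen (W p)) \<in> QB.tgt.seqs" if "p \<in> carrier ZZ" for p
    using that by (intro QB.tgt.seqs_const) (simp add: bq_gens_simps)
  have factors: "?\<sigma> \<in> zz_A" "?\<tau> \<in> zz_U"
    using sgn a by (auto simp: zz_A_def zz_U_def)
  have "zz_s ?\<sigma> \<otimes>\<^bsub>BQ ZZ\<^esub> zz_t ?\<tau> = QB.tgt.cls (\<lambda>_. gen (W ?\<sigma>) * gen (W ?\<tau>))"
    using factors QB.tgt.cls_mult[OF const[OF carr(1)] const[OF carr(2)]]
    by (simp only: zz_s_def zz_t_def restrict_apply' bq_w_def univ_gen_def BQ_def)
  also have "\<dots> = QB.tgt.cls (\<lambda>_. gen (W (0, a)))"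
  proof (rule QB.tgt.cls_eqI[OF QB.tgt.rel_null])
    have "abs_bq_alg (gen (W ?\<sigma>) * gen (W ?\<tau>)) = abs_bq_alg (gen (W (0, a)))"
      using bq.w_mult[OF carr] factor by (simp add: star_hom_simps[OF star_hom_abs_bq])
    moreover have free: "gen (W ?\<sigma>) * gen (W ?\<tau>) \<in> free_alg (bq_gens ZZ)" "gen (W (0, a)) \<in> free_alg (bq_gens ZZ)"
      using a carr by (auto intro!: free_alg_mult simp: bq_gens_simps)
    ultimately show "QB.tgt.nrm (gen (W ?\<sigma>) * gen (W ?\<tau>) - gen (W (0, a))) = 0"
      by (intro QB.tgt.nrm_null free_alg_diff) (assumption | rule abs_bq_eqD)+
    show "(\<lambda>_. gen (W ?\<sigma>) * gen (W ?\<tau>)) \<in> QB.tgt.seqs" "(\<lambda>_. gen (W (0, a))) \<in> QB.tgt.seqs"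
      by (intro QB.tgt.seqs_const free)+
  qed
  finally show "QB.induced (qz_v a) = zz_s ?\<sigma> \<otimes>\<^bsub>BQ ZZ\<^esub> zz_t ?\<tau>"
    using induced_const[of "gen (V a)"] a by (simp add: qz_v_def univ_gen_def qz_gens_def to_bq_def)
qed

end
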